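(* Let $R$ be a finite commutative ring in which $2$ is a unit and let $\mathbb{K}$ be a Noetherian ring. Then the category $\mathrm{Rep}_{\mathbb{K}}(\mathbf{OrI}(R))$ of $\mathbf{OrI}(R)$-modules over $\mathbb{K}$ is locally Noetherian; that is, every submodule of a finitely generated $\mathbf{OrI}(R)$-module over $\mathbb{K}$ is finitely generated.
   Context: Rings are unital. An orthogonal $R$-module is a pair $(V,B)$ with $V$ a free $R$-module of finite rank and $B:V\times V\to R$ a symmetric bilinear form that is non-degenerate, i.e. induces an isomorphism $V\to \mathrm{Hom}_R(V,R)$. An isometry $(V,B_V)\to(W,B_W)$ is an $R$-linear map $\phi:V\to W$ with $B_V(v,w)=B_W(\phi(v),\phi(w))$ for all $v,w\in V$ (such maps are automatically injective, not necessarily bijective). $\mathbf{OrI}(R)$ is the category whose objects are orthogonal $R$-modules and whose morphisms are isometries. For a category $\mathcal{C}$, a $\mathcal{C}$-module over $\mathbb{K}$ is a functor $M:\mathcal{C}\to\mathbf{Mod}_{\mathbb{K}}$; morphisms are natural transformations; submodules are defined pointwise. A $\mathcal{C}$-module $M$ is finitely generated if there are finitely many objects $C_1,\dots,C_n$ and elements $x_i\in M(C_i)$ such that any submodule $N\subseteq M$ with $x_i\in N(C_i)$ for all $i$ equals $M$. $M$ is Noetherian if every submodule of $M$ is finitely generated. *)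

theory Defs
  imports "HOL-Algebra.Module"
begin

section \<open>Modules over possibly non-commutative rings\<close>

text \<open>
  The locale \<^locale>\<open>module\<close> insists on a commutative ring of scalars.  The
  coefficient ring of a representation need not be commutative, so we use left modules for it;
  submodules are those of the library (\<^locale>\<open>submodule\<close> puts no condition on the scalars).
\<close>

locale left_module = R?: ring R + M?: abelian_group M
  for R :: "('k, 'c) ring_scheme" (structure) and M :: "('k, 'm, 'd) module_scheme" (structure) +
  assumes smult_closed:
      "\<lbrakk>a \<in> carrier R; x \<in> carrier M\<rbrakk> \<Longrightarrow> a \<odot>\<^bsub>M\<^esub> x \<in> carrier M"
    and smult_l_distr:
      "\<lbrakk>a \<in> carrier R; b \<in> carrier R; x \<in> carrier M\<rbrakk> \<Longrightarrow>
        (a \<oplus>\<^bsub>R\<^esub> b) \<odot>\<^bsub>M\<^esub> x = a \<odot>\<^bsub>M\<^esub> x \<oplus>\<^bsub>M\<^esub> b \<odot>\<^bsub>M\<^esub> x"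
    and smult_r_distr:
      "\<lbrakk>a \<in> carrier R; x \<in> carrier M; y \<in> carrier M\<rbrakk> \<Longrightarrow>
        a \<odot>\<^bsub>M\<^esub> (x \<oplus>\<^bsub>M\<^esub> y) = a \<odot>\<^bsub>M\<^esub> x \<oplus>\<^bsub>M\<^esub> a \<odot>\<^bsub>M\<^esub> y"
    and smult_assoc1:
      "\<lbrakk>a \<in> carrier R; b \<in> carrier R; x \<in> carrier M\<rbrakk> \<Longrightarrow>
        (a \<otimes>\<^bsub>R\<^esub> b) \<odot>\<^bsub>M\<^esub> x = a \<odot>\<^bsub>M\<^esub> (b \<odot>\<^bsub>M\<^esub> x)"
    and smult_one:
      "x \<in> carrier M \<Longrightarrow> \<one>\<^bsub>R\<^esub> \<odot>\<^bsub>M\<^esub> x = x"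

definition linear_maps ::
  "('k, 'c) ring_scheme \<Rightarrow> ('k, 'm, 'd) module_scheme \<Rightarrow> ('k, 'n, 'e) module_scheme \<Rightarrow> ('m \<Rightarrow> 'n) set"
where
  "linear_maps R V W =
    {f \<in> carrier V \<rightarrow> carrier W.
      (\<forall>x\<in>carrier V. \<forall>y\<in>carrier V. f (x \<oplus>\<^bsub>V\<^esub> y) = f x \<oplus>\<^bsub>W\<^esub> f y) \<and>
      (\<forall>a\<in>carrier R. \<forall>x\<in>carrier V. f (a \<odot>\<^bsub>V\<^esub> x) = a \<odot>\<^bsub>W\<^esub> f x)}"

definition self_module :: "('k, 'c) ring_scheme \<Rightarrow> ('k, 'k) module" where
  "self_module R =
    \<lparr>carrier = carrier R, mult = mult R, one = one R, zero = zero R, add = add R, smult = mult R\<rparr>"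

text \<open>
  The library's \<open>noetherian_ring\<close> speaks about two-sided ideals, which is too weak for
  a non-commutative ring.  The submodules of \<^term>\<open>self_module K\<close> are the left ideals of
  \<open>K\<close>.  For commutative \<open>K\<close> this is the usual notion.
\<close>

locale left_noetherian_ring = ring K for K :: "('k, 'c) ring_scheme" (structure) +
  assumes left_ideals_finitely_generated:
    "submodule I K (self_module K) \<Longrightarrow>
      \<exists>A. finite A \<and> A \<subseteq> I \<and> (\<forall>J. submodule J K (self_module K) \<and> A \<subseteq> J \<longrightarrow> I \<subseteq> J)"


section \<open>Categories and their representations\<close>

text \<open>
  Morphisms do not carry their domain and codomain, so composition and functors take the objects
  as arguments: \<open>Cmp C X Y Z g f\<close> is \<open>g \<circ> f\<close> for \<open>f : X \<rightarrow> Y\<close> and \<open>g : Y \<rightarrow> Z\<close>.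
\<close>

record ('o, 'a) category_data =
  Ob :: "'o set"
  Mor :: "'o \<Rightarrow> 'o \<Rightarrow> 'a set"
  Idt :: "'o \<Rightarrow> 'a"
  Cmp :: "'o \<Rightarrow> 'o \<Rightarrow> 'o \<Rightarrow> 'a \<Rightarrow> 'a \<Rightarrow> 'a"

locale category =
  fixes C :: "('o, 'a) category_data"
  assumes Idt_closed: "X \<in> Ob C \<Longrightarrow> Idt C X \<in> Mor C X X"
    and Cmp_closed:
      "\<lbrakk>X \<in> Ob C; Y \<in> Ob C; Z \<in> Ob C; f \<in> Mor C X Y; g \<in> Mor C Y Z\<rbrakk> \<Longrightarrow>
        Cmp C X Y Z g f \<in> Mor C X Z"
    and Cmp_Idt_right:
      "\<lbrakk>X \<in> Ob C; Y \<in> Ob C; f \<in> Mor C X Y\<rbrakk> \<Longrightarrow> Cmp C X X Y f (Idt C X) = f"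
    and Cmp_Idt_left:
      "\<lbrakk>X \<in> Ob C; Y \<in> Ob C; f \<in> Mor C X Y\<rbrakk> \<Longrightarrow> Cmp C X Y Y (Idt C Y) f = f"
    and Cmp_assoc:
      "\<lbrakk>W \<in> Ob C; X \<in> Ob C; Y \<in> Ob C; Z \<in> Ob C; f \<in> Mor C W X; g \<in> Mor C X Y; h \<in> Mor C Y Z\<rbrakk> \<Longrightarrow>
        Cmp C W X Z (Cmp C X Y Z h g) f = Cmp C W Y Z h (Cmp C W X Y g f)"

record ('o, 'a, 'k, 'm) cmodule_data =
  obj_map :: "'o \<Rightarrow> ('k, 'm) module"
  mor_map :: "'o \<Rightarrow> 'o \<Rightarrow> 'a \<Rightarrow> 'm \<Rightarrow> 'm"

text \<open>
  A functor from \<open>C\<close> to left \<open>K\<close>-modules.  The maps \<open>mor_map M X Y f\<close> only matter on the carrier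
  of \<open>obj_map M X\<close>, hence the functor laws are required there.
\<close>

locale cmodule = category C
  for C :: "('o, 'a) category_data" +
  fixes K :: "'k ring" and M :: "('o, 'a, 'k, 'm) cmodule_data"
  assumes obj_map_module: "X \<in> Ob C \<Longrightarrow> left_module K (obj_map M X)"
    and mor_map_linear:
      "\<lbrakk>X \<in> Ob C; Y \<in> Ob C; f \<in> Mor C X Y\<rbrakk> \<Longrightarrow>
        mor_map M X Y f \<in> linear_maps K (obj_map M X) (obj_map M Y)"
    and mor_map_Idt:
      "\<lbrakk>X \<in> Ob C; x \<in> carrier (obj_map M X)\<rbrakk> \<Longrightarrow> mor_map M X X (Idt C X) x = x"
    and mor_map_Cmp:
      "\<lbrakk>X \<in> Ob C; Y \<in> Ob C; Z \<in> Ob C; f \<in> Mor C X Y; g \<in> Mor C Y Z;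
        x \<in> carrier (obj_map M X)\<rbrakk> \<Longrightarrow>
        mor_map M X Z (Cmp C X Y Z g f) x = mor_map M Y Z g (mor_map M X Y f x)"

definition csubmodule ::
  "('o, 'a) category_data \<Rightarrow> 'k ring \<Rightarrow> ('o, 'a, 'k, 'm) cmodule_data \<Rightarrow> ('o \<Rightarrow> 'm set) \<Rightarrow> bool"
where
  "csubmodule C K M N \<longleftrightarrow>
    (\<forall>X\<in>Ob C. submodule (N X) K (obj_map M X)) \<and>
    (\<forall>X\<in>Ob C. \<forall>Y\<in>Ob C. \<forall>f\<in>Mor C X Y. mor_map M X Y f ` N X \<subseteq> N Y)"

definition restrict_cmodule ::
  "('o, 'a, 'k, 'm) cmodule_data \<Rightarrow> ('o \<Rightarrow> 'm set) \<Rightarrow> ('o, 'a, 'k, 'm) cmodule_data"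
where
  "restrict_cmodule M N =
    \<lparr>obj_map = (\<lambda>X. (obj_map M X)\<lparr>carrier := N X\<rparr>), mor_map = mor_map M\<rparr>"

definition finitely_generated ::
  "('o, 'a) category_data \<Rightarrow> 'k ring \<Rightarrow> ('o, 'a, 'k, 'm) cmodule_data \<Rightarrow> bool"
where
  "finitely_generated C K M \<longleftrightarrow>
    (\<exists>S. finite S \<and> S \<subseteq> (SIGMA X : Ob C. carrier (obj_map M X)) \<and>
      (\<forall>N. csubmodule C K M N \<and> (\<forall>(X, x)\<in>S. x \<in> N X) \<longrightarrow>
        (\<forall>X\<in>Ob C. N X = carrier (obj_map M X))))"

definition noetherian_cmodule ::
  "('o, 'a) category_data \<Rightarrow> 'k ring \<Rightarrow> ('o, 'a, 'k, 'm) cmodule_data \<Rightarrow> bool"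
where
  "noetherian_cmodule C K M \<longleftrightarrow>
    (\<forall>N. csubmodule C K M N \<longrightarrow> finitely_generated C K (restrict_cmodule M N))"


section \<open>The category of orthogonal modules and isometries\<close>

definition is_basis :: "'r ring \<Rightarrow> ('r, 'v) module \<Rightarrow> nat \<Rightarrow> (nat \<Rightarrow> 'v) \<Rightarrow> bool" where
  "is_basis R V n b \<longleftrightarrow>
    b \<in> {..<n} \<rightarrow> carrier V \<and>
    (\<forall>v\<in>carrier V. \<exists>!c. c \<in> {..<n} \<rightarrow>\<^sub>E carrier R \<and> v = (\<Oplus>\<^bsub>V\<^esub>i\<in>{..<n}. c i \<odot>\<^bsub>V\<^esub> b i))"

text \<open>
  Non-degeneracy says that \<open>v \<mapsto> B(v, -)\<close> is an isomorphism from \<open>V\<close> to \<open>Hom\<^sub>R(V, R)\<close>; it is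
  linear by bilinearity, so bijectivity is what remains.  Linear forms are taken extensional
  (undefined outside the carrier) so that each one is represented by exactly one function.
\<close>

locale orthogonal_module = module R V
  for R :: "'r ring" (structure) and V :: "('r, 'v) module" (structure) +
  fixes B :: "'v \<Rightarrow> 'v \<Rightarrow> 'r"
  assumes free_of_finite_rank: "\<exists>n b. is_basis R V n b"
    and linear_left: "w \<in> carrier V \<Longrightarrow> (\<lambda>v. B v w) \<in> linear_maps R V (self_module R)"
    and linear_right: "v \<in> carrier V \<Longrightarrow> B v \<in> linear_maps R V (self_module R)"
    and symmetric: "\<lbrakk>v \<in> carrier V; w \<in> carrier V\<rbrakk> \<Longrightarrow> B v w = B w v"
    and nondegenerate:
      "bij_betw (\<lambda>v. \<lambda>w\<in>carrier V. B v w) (carrier V)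
        (linear_maps R V (self_module R) \<inter> extensional (carrier V))"

type_synonym ('r, 'v) form_module = "('r, 'v) module \<times> ('v \<Rightarrow> 'v \<Rightarrow> 'r)"

definition isometries ::
  "'r ring \<Rightarrow> ('r, 'v) form_module \<Rightarrow> ('r, 'v) form_module \<Rightarrow> ('v \<Rightarrow> 'v) set"
where
  "isometries R X Y =
    {f \<in> linear_maps R (fst X) (fst Y) \<inter> extensional (carrier (fst X)).
      \<forall>v\<in>carrier (fst X). \<forall>w\<in>carrier (fst X). snd X v w = snd Y (f v) (f w)}"

text \<open>
  The underlying sets of the objects live in the type \<open>'v\<close>.  If \<open>R\<close> is finite and
  \<open>'v\<close> infinite, every orthogonal \<open>R\<close>-module is isomorphic to such an object.
\<close>

definition OrI :: "'r ring \<Rightarrow> (('r, 'v) form_module, 'v \<Rightarrow> 'v) category_data" where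
  "OrI R =
    \<lparr>Ob = {(V, B). orthogonal_module R V B},
     Mor = isometries R,
     Idt = (\<lambda>X. \<lambda>v\<in>carrier (fst X). v),
     Cmp = (\<lambda>X Y Z g f. compose (carrier (fst X)) g f)\<rparr>"

lemma category_OrI: "category (OrI R :: (('r, 'v) form_module, 'v \<Rightarrow> 'v) category_data)"
proof
  fix X :: "('r, 'v) form_module"
  assume "X \<in> Ob (OrI R)"
  then interpret V: module R "fst X"
    by (auto simp: OrI_def orthogonal_module_def)
  show "Idt (OrI R) X \<in> Mor (OrI R) X X"
    by (auto simp: OrI_def isometries_def linear_maps_def)
next
  fix X Y Z :: "('r, 'v) form_module" and f g
  assume obs: "X \<in> Ob (OrI R)" "Y \<in> Ob (OrI R)" "Z \<in> Ob (OrI R)"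
    and f: "f \<in> Mor (OrI R) X Y" and g: "g \<in> Mor (OrI R) Y Z"
  interpret V: module R "fst X"
    using obs by (auto simp: OrI_def orthogonal_module_def)
  have f_in: "f x \<in> carrier (fst Y)" if "x \<in> carrier (fst X)" for x
    using f that by (auto simp: OrI_def isometries_def linear_maps_def)
  show "Cmp (OrI R) X Y Z g f \<in> Mor (OrI R) X Z"
    using f g f_in by (auto simp: OrI_def isometries_def linear_maps_def compose_def)
next
  fix X Y :: "('r, 'v) form_module" and f
  assume f: "f \<in> Mor (OrI R) X Y"
  then show "Cmp (OrI R) X X Y f (Idt (OrI R) X) = f"
    by (auto simp: OrI_def isometries_def compose_def extensional_def fun_eq_iff)
  show "Cmp (OrI R) X Y Y (Idt (OrI R) Y) f = f"
    using f by (auto simp: OrI_def isometries_def linear_maps_def compose_def extensional_def fun_eq_iff)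
next
  fix W X Y Z :: "('r, 'v) form_module" and f g h
  assume "f \<in> Mor (OrI R) W X"
  then show "Cmp (OrI R) W X Z (Cmp (OrI R) X Y Z h g) f =
      Cmp (OrI R) W Y Z h (Cmp (OrI R) W X Y g f)"
    by (auto simp: OrI_def isometries_def linear_maps_def compose_def fun_eq_iff)
qed

end

theory Submission
  imports
    Defs
    "HOL-Library.Sublist"
    "HOL-Library.Ramsey"
    "HOL-Library.List_Lexorder"
    "HOL-Library.Countable_Set"
begin

text \<open>
  Over a finite ring in which 2 is invertible, every orthogonal module \<open>Y\<close> is an orthogonal sum of
  cyclic modules \<open>R v\<^sub>k\<close>, and \<open>y = (\<Sum>k. q\<^sub>k B(y, v\<^sub>k) v\<^sub>k)\<close> with \<open>q\<^sub>k\<close> a quasi-inverse of \<open>B(v\<^sub>k, v\<^sub>k)\<close>.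
  An isometry \<open>f : X \<rightarrow> Y\<close> is thus a word whose \<open>k\<close>-th letter records \<open>B(v\<^sub>k, v\<^sub>k)\<close>, \<open>q\<^sub>k\<close> and the linear form
  \<open>x \<mapsto> B(f x, v\<^sub>k)\<close>; for fixed \<open>X\<close> the alphabet is finite.  A surjection between index sets that preserves
  the first two entries and whose fibres have size congruent to 1 modulo \<open>|R|\<close> induces an isometry
  \<open>v\<^sub>p \<mapsto> (\<Sum>k\<in>s\<^sup>-\<^sup>1(p). v'\<^sub>k)\<close>, and composition with it is the pullback of words along the surjection.  By Higman's
  lemma, pullback along such surjections, taken so that they respect the lexicographic order, is a well-quasi-order on
  words, and a Groebner basis argument with left ideals of leading coefficients applies.
\<close>

section \<open>Words under congruent folds\<close>

text \<open>The modulus |R| answers an obstacle: an embedding of words alone does not respect the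
  form. By \<open>frame_parseval\<close> the value \<open>B y z\<close> is a sum over the positions
  of a frame, and a fold repeats the summand at p once for each element of the fibre over p. Since
  |R| annihilates the additive group of R, these repetitions are harmless as soon as every fibre has
  size congruent to 1 modulo |R|. Residues of letter counts take finitely many values, so this
  demand costs only a pigeonhole step on top of Higman's lemma. Invertibility of 2 serves
  polarization, which keeps the splitting off of cyclic summands going until nothing is left. The
  frames of different objects are chosen independently of each other; what ties them together is
  that every letter carries the norm and the quasi-inverse of its frame vector, and these are the
  data that a folded map has to match. The elements M(f)(x) may satisfy linear relations over K, so
  an element does not determine a leading coefficient. The left ideals therefore collect the
  coefficients of all representations of an element.\<close>

text \<open>Nash-Williams' minimal bad sequence argument. Letters are compared by equality, so
  pigeonhole on the first letters takes the place of a well-quasi-order on the alphabet.\<close>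

lemma higman_finite_alphabet:
  fixes w :: "nat \<Rightarrow> 'a list"
  assumes A: "finite A" and w: "\<And>i. set (w i) \<subseteq> A"
  shows "\<exists>i j. i < j \<and> subseq (w i) (w j)"
proof (rule ccontr)
  define Bad where "Bad g \<longleftrightarrow> (\<forall>i. set (g i) \<subseteq> A) \<and> (\<forall>i j. i < j \<longrightarrow> \<not> subseq (g i) (g j))"
    for g :: "nat \<Rightarrow> 'a list"
  define Min where "Min n g \<longleftrightarrow> Bad g \<and>
    (\<forall>h. Bad h \<and> (\<forall>i<n. h i = g i) \<longrightarrow> length (g n) \<le> length (h n))" for n g
  assume "\<not> ?thesis"
  then have bad_w: "Bad w" using w by (auto simp: Bad_def)
  have refine: "\<exists>y. Min n y \<and> (\<forall>i<n. y i = x i)" if "Bad x" for n x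
  proof -
    have "\<exists>y. (Bad y \<and> (\<forall>i<n. y i = x i)) \<and>
        (\<forall>z. Bad z \<and> (\<forall>i<n. z i = x i) \<longrightarrow> length (y n) \<le> length (z n))"
      using ex_has_least_nat[of "\<lambda>y. Bad y \<and> (\<forall>i<n. y i = x i)" x "\<lambda>y. length (y n)"] that by auto
    then obtain y where y: "Bad y" "\<forall>i<n. y i = x i"
      and least: "\<And>z. Bad z \<Longrightarrow> \<forall>i<n. z i = x i \<Longrightarrow> length (y n) \<le> length (z n)" by auto
    have "Min n y" unfolding Min_def using y least by auto
    then show ?thesis using y by auto
  qed
  have "\<exists>F. \<forall>n. Min n (F n) \<and> (\<forall>i<Suc n. F (Suc n) i = F n i)"
  proof (rule dependent_nat_choice)
    show "\<exists>x. Min 0 x" using refine[OF bad_w, of 0] by auto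
    show "\<exists>y. Min (Suc n) y \<and> (\<forall>i<Suc n. y i = x i)" if "Min n x" for x n
      using refine[of x "Suc n"] that by (auto simp: Min_def)
  qed
  then obtain F where F: "\<And>n. Min n (F n)" and agree: "\<And>n i. i \<le> n \<Longrightarrow> F (Suc n) i = F n i"
    by (auto simp: less_Suc_eq_le)
  \<comment> \<open>The diagonal of the successive refinements: \<open>F k\<close> agrees with
    \<open>m\<close> up to index k, so \<open>m\<close> is bad, and each \<open>m n\<close> is
    shortest among the bad sequences with the same earlier terms.\<close>
  define m where "m n = F n n" for n
  have Fm: "F k i = m i" if "i \<le> k" for i k
    using that by (induction k rule: dec_induct) (simp_all add: m_def agree)
  have bad_F: "Bad (F n)" for n using F[of n] by (simp add: Min_def)
  have bad_m: "\<not> subseq (m i) (m j)" if "i < j" for i j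
    using bad_F[of j] Fm[of i j] Fm[of j j] that unfolding Bad_def by (metis less_imp_le order_refl)
  have set_m: "set (m i) \<subseteq> A" for i using bad_F[of i] by (auto simp: Bad_def m_def)
  have ne: "m i \<noteq> []" for i using bad_m[of i "Suc i"] by auto
  have "finite (range (\<lambda>i. hd (m i)))"
    by (rule finite_subset[OF _ A]) (use set_m ne hd_in_set in fast)
  from pigeonhole_infinite[OF infinite_UNIV_nat this]
  obtain a where inf: "infinite {i. hd (m i) = hd (m a)}" by auto
  define e where "e = enumerate {i. hd (m i) = hd (m a)}"
  have e_in: "hd (m (e i)) = hd (m a)" for i
    using enumerate_in_set[OF inf] by (auto simp: e_def)
  have e_mono: "strict_mono e" unfolding e_def by (rule strict_mono_enumerate[OF inf])
  \<comment> \<open>Follow \<open>m\<close> up to the first index of the constant-letter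
    subsequence, then that subsequence with its common first letter removed. This is bad again but
    shorter at \<open>e 0\<close>, against minimality.\<close>
  define h where "h i = (if i < e 0 then m i else tl (m (e (i - e 0))))" for i
  have "Bad h"
    unfolding Bad_def
  proof (intro conjI allI impI)
    fix i show "set (h i) \<subseteq> A"
      using set_m ne by (auto simp: h_def dest!: list.set_sel(2)[rotated])
  next
    fix i j :: nat assume ij: "i < j"
    consider "j < e 0" | "i < e 0" "\<not> j < e 0" | "\<not> i < e 0" "\<not> j < e 0" using ij by linarith
    then show "\<not> subseq (h i) (h j)"
    proof cases
      case 1 then show ?thesis using bad_m[OF ij] ij by (simp add: h_def)
    next
      case 2
      have "e 0 \<le> e (j - e 0)" using e_mono by (simp add: strict_mono_less_eq)
      then have "\<not> subseq (m i) (m (e (j - e 0)))" using bad_m 2 by simp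
      moreover have "subseq (tl (m (e (j - e 0)))) (m (e (j - e 0)))"
        by (cases "m (e (j - e 0))") auto
      ultimately show ?thesis using 2 by (auto simp: h_def dest: subseq_order.trans)
    next
      case 3
      let ?x = "m (e (i - e 0))" and ?y = "m (e (j - e 0))"
      have "e (i - e 0) < e (j - e 0)" using e_mono ij 3 by (simp add: strict_mono_less)
      then have "\<not> subseq ?x ?y" using bad_m by simp
      moreover have "?x = hd (m a) # tl ?x" "?y = hd (m a) # tl ?y"
        using e_in ne by (metis list.collapse)+
      ultimately show ?thesis using 3 by (metis h_def subseq_Cons2)
    qed
  qed
  moreover have "\<forall>i<e 0. h i = F (e 0) i" using Fm by (simp add: h_def)
  ultimately have "length (F (e 0) (e 0)) \<le> length (h (e 0))" using F[of "e 0"] by (auto simp: Min_def)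
  moreover have "F (e 0) (e 0) = m (e 0)" "h (e 0) = tl (m (e 0))" by (simp_all add: h_def m_def)
  ultimately have "length (m (e 0)) \<le> length (m (e 0)) - 1" by (metis length_tl)
  moreover have "0 < length (m (e 0))" using ne by blast
  ultimately show False by linarith
qed

lemma subseq_index_map:
  assumes "subseq xs ys"
  shows "\<exists>\<phi>. strict_mono_on {..<length xs} \<phi> \<and> (\<forall>p<length xs. \<phi> p < length ys \<and> ys ! \<phi> p = xs ! p)"
  using assms
proof (induction rule: list_emb.induct)
  case (list_emb_Nil ys)
  then show ?case by (auto simp: strict_mono_on_def)
next
  case (list_emb_Cons xs ys y)
  then obtain \<phi> where "strict_mono_on {..<length xs} \<phi>"
    "\<forall>p<length xs. \<phi> p < length ys \<and> ys ! \<phi> p = xs ! p" by auto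
  then show ?case by (intro exI[of _ "Suc \<circ> \<phi>"]) (auto simp: strict_mono_on_def)
next
  case (list_emb_Cons2 x y xs ys)
  then obtain \<phi> where \<phi>: "strict_mono_on {..<length xs} \<phi>"
    "\<forall>p<length xs. \<phi> p < length ys \<and> ys ! \<phi> p = xs ! p" by auto
  have "strict_mono_on {..<length (x # xs)} (case_nat 0 (Suc \<circ> \<phi>))"
    using \<phi> by (auto simp: strict_mono_on_def less_Suc_eq_0_disj split: nat.splits)
  then show ?case using \<phi> list_emb_Cons2
    by (intro exI[of _ "case_nat 0 (Suc \<circ> \<phi>)"]) (auto simp: less_Suc_eq_0_disj)
qed

text \<open>
  The last clause says that \<open>\<phi> p\<close> is the least element of the fibre over \<open>p\<close> and that \<open>\<phi>\<close> is increasing; it makes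
  pullback along \<open>s\<close> monotone for the lexicographic order.
\<close>
definition congruent_fold :: "nat \<Rightarrow> 'a list \<Rightarrow> 'a list \<Rightarrow> (nat \<Rightarrow> nat) \<Rightarrow> bool" where
  "congruent_fold l xs ys s \<longleftrightarrow>
    (\<forall>k<length ys. s k < length xs \<and> ys ! k = xs ! s k) \<and>
    (\<forall>p<length xs. card {k. k < length ys \<and> s k = p} mod l = 1 mod l) \<and>
    (\<exists>\<phi>. strict_mono_on {..<length xs} \<phi> \<and> (\<forall>p<length xs. \<phi> p < length ys \<and> s (\<phi> p) = p) \<and>
      (\<forall>k<length ys. \<phi> (s k) \<le> k))"

definition mark_repeats :: "'a list \<Rightarrow> ('a \<times> bool) list" where
  "mark_repeats xs = map (\<lambda>k. (xs ! k, xs ! k \<in> set (take k xs))) [0..<length xs]"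

lemma length_mark_repeats [simp]: "length (mark_repeats xs) = length xs"
  by (simp add: mark_repeats_def)

text \<open>
  All positions outside the embedded copy of \<open>xs\<close> are sent to the first occurrence of their letter.  The marks
  force first occurrences to be embedded as first occurrences, so no such position precedes the least element of
  its fibre.
\<close>
lemma congruent_fold_if_subseq:
  assumes sub: "subseq (mark_repeats xs) (mark_repeats ys)" and sets: "set ys \<subseteq> set xs"
    and counts: "\<And>a. a \<in> set xs \<Longrightarrow>
      card {k. k < length xs \<and> xs ! k = a} mod l = card {k. k < length ys \<and> ys ! k = a} mod l"
  shows "\<exists>s. congruent_fold l xs ys s"
proof -
  let ?m = "length xs" and ?n = "length ys"
  from subseq_index_map[OF sub] obtain \<phi> where mono: "strict_mono_on {..<?m} \<phi>"
    and \<phi>: "\<And>p. p < ?m \<Longrightarrow> \<phi> p < ?n \<and> mark_repeats ys ! \<phi> p = mark_repeats xs ! p" by auto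
  have \<phi>_nth: "ys ! \<phi> p = xs ! p"
    and \<phi>_rep: "xs ! p \<in> set (take p xs) \<longleftrightarrow> ys ! \<phi> p \<in> set (take (\<phi> p) ys)" if "p < ?m" for p
    using \<phi>[OF that] that by (auto simp: mark_repeats_def)
  have inj: "inj_on \<phi> {..<?m}" using mono by (rule strict_mono_on_imp_inj_on)
  define first where "first a = (LEAST p. p < ?m \<and> xs ! p = a)" for a
  have first: "first a < ?m" "xs ! first a = a" if "a \<in> set xs" for a
  proof -
    have "\<exists>p. p < ?m \<and> xs ! p = a" using that by (auto simp: in_set_conv_nth)
    from LeastI_ex[OF this] show "first a < ?m" "xs ! first a = a" by (auto simp: first_def)
  qed
  have first_\<phi>: "\<phi> (first a) \<le> k" if a: "a \<in> set xs" and k: "k < ?n" "ys ! k = a" for a k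
  proof -
    have "a \<notin> set (take (first a) xs)"
    proof
      assume "a \<in> set (take (first a) xs)"
      then obtain p where "p < first a" "p < ?m" "xs ! p = a" by (auto simp: in_set_conv_nth)
      then show False using not_less_Least[of p "\<lambda>p. p < ?m \<and> xs ! p = a"] by (auto simp: first_def)
    qed
    then have "a \<notin> set (take (\<phi> (first a)) ys)" using \<phi>_rep[of "first a"] \<phi>_nth[of "first a"] first[OF a] by simp
    then show ?thesis using k by (metis in_set_conv_nth length_take min_less_iff_conj not_le nth_take)
  qed
  define s where "s k = (if k \<in> \<phi> ` {..<?m} then inv_into {..<?m} \<phi> k else first (ys ! k))" for k
  have s_\<phi>: "s (\<phi> p) = p" if "p < ?m" for p using that inj by (simp add: s_def)
  have s_notin: "s k = first (ys ! k)" if "k \<notin> \<phi> ` {..<?m}" for k using that by (simp add: s_def)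
  have ys_in: "ys ! k \<in> set xs" if "k < ?n" for k using sets that by auto
  have s: "s k < ?m \<and> ys ! k = xs ! s k \<and> \<phi> (s k) \<le> k" if k: "k < ?n" for k
  proof (cases "k \<in> \<phi> ` {..<?m}")
    case True then show ?thesis using s_\<phi> \<phi>_nth by auto
  next
    case False
    then show ?thesis using s_notin[OF False] first[OF ys_in[OF k]] first_\<phi>[OF ys_in[OF k] k] by simp
  qed
  have "card {k. k < ?n \<and> s k = p} mod l = 1 mod l" if p: "p < ?m" for p
  proof -
    \<comment> \<open>The part of the fibre over p besides the embedded position
      \<open>\<phi> p\<close>; the residue 1 asks for its size to be divisible by l.\<close>
    let ?E = "{k. k < ?n \<and> k \<notin> \<phi> ` {..<?m} \<and> first (ys ! k) = p}"
    have "{k. k < ?n \<and> s k = p} = insert (\<phi> p) ?E"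
    proof (intro equalityI subsetI)
      fix k assume "k \<in> {k. k < ?n \<and> s k = p}"
      then show "k \<in> insert (\<phi> p) ?E" using s_\<phi> s_notin[of k] by (cases "k \<in> \<phi> ` {..<?m}") auto
    next
      fix k assume "k \<in> insert (\<phi> p) ?E"
      then show "k \<in> {k. k < ?n \<and> s k = p}" using s_\<phi>[OF p] \<phi>[OF p] s_notin[of k] by auto
    qed
    then have card: "card {k. k < ?n \<and> s k = p} = Suc (card ?E)"
      using p by auto
    have "card ?E mod l = 0"
    proof (cases "p = first (xs ! p)")
      case False
      have "first (ys ! k) \<noteq> p" if "k < ?n" for k
        using False first(2)[OF ys_in[OF that]] by auto
      then have "?E = {}" by blast
      then show ?thesis by (simp only: card.empty mod_0)
    next
      case True
      let ?a = "xs ! p" and ?P = "{q. q < ?m \<and> xs ! q = xs ! p}"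
      have a: "?a \<in> set xs" using p by simp
      \<comment> \<open>At a first occurrence the surplus consists of all occurrences of the letter
        in \<open>ys\<close> that are not images of its occurrences in \<open>xs\<close>. Its size
        is a difference of two counts that agree modulo l.\<close>
      have E: "?E = {k. k < ?n \<and> ys ! k = ?a} - \<phi> ` ?P"
      proof (intro equalityI subsetI)
        fix k assume "k \<in> ?E"
        then have "k < ?n" "first (ys ! k) = p" "k \<notin> \<phi> ` ?P" by auto
        then show "k \<in> {k. k < ?n \<and> ys ! k = ?a} - \<phi> ` ?P" using first(2)[OF ys_in, of k] by simp
      next
        fix k assume k: "k \<in> {k. k < ?n \<and> ys ! k = ?a} - \<phi> ` ?P"
        moreover have "k \<notin> \<phi> ` {..<?m}"
        proof
          assume "k \<in> \<phi> ` {..<?m}"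
          then obtain q where "q < ?m" "k = \<phi> q" by auto
          then show False using k \<phi>_nth by auto
        qed
        ultimately show "k \<in> ?E" using True by simp
      qed
      have sub: "\<phi> ` ?P \<subseteq> {k. k < ?n \<and> ys ! k = ?a}" using \<phi> \<phi>_nth by auto
      have "card (\<phi> ` ?P) = card ?P" by (rule card_image) (rule inj_on_subset[OF inj], auto)
      then have "card ?E = card {k. k < ?n \<and> ys ! k = ?a} - card ?P"
        and le: "card ?P \<le> card {k. k < ?n \<and> ys ! k = ?a}"
        using card_Diff_subset[OF _ sub] card_mono[OF _ sub] E by auto
      then show ?thesis using counts[OF a] by (simp add: mod_eq_dvd_iff_nat[symmetric])
    qed
    then show ?thesis unfolding card using mod_Suc_eq[of "card ?E" l] by simp
  qed
  then show ?thesis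
    unfolding congruent_fold_def using mono \<phi> s_\<phi> s by blast
qed

text \<open>The set of letters of a word and its letter counts modulo l take finitely many values,
  so they are constant on a subsequence. Higman's lemma for the marked words, over the doubled
  alphabet, supplies the embedding that \<open>congruent_fold_if_subseq\<close> asks for.\<close>

lemma congruent_fold_wqo:
  fixes w :: "nat \<Rightarrow> 'a list"
  assumes A: "finite A" and w: "\<And>i. set (w i) \<subseteq> A" and l: "l > 0"
  shows "\<exists>i j s. i < j \<and> congruent_fold l (w i) (w j) s"
proof -
  define cnt where "cnt xs a = card {k. k < length xs \<and> xs ! k = a} mod l" for xs and a :: 'a
  define col where "col i = (set (w i), restrict (cnt (w i)) A)" for i
  have "finite (range col)"
  proof (rule finite_subset)
    show "range col \<subseteq> Pow A \<times> (A \<rightarrow>\<^sub>E {..<l})" using w l by (auto simp: col_def cnt_def)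
  qed (auto simp: A intro!: finite_PiE finite_cartesian_product)
  from pigeonhole_infinite[OF infinite_UNIV_nat this]
  obtain c where inf: "infinite {i. col i = col c}" by auto
  define e where "e = enumerate {i. col i = col c}"
  have e_in: "col (e i) = col c" for i
    using enumerate_in_set[OF inf] by (auto simp: e_def)
  have e_mono: "strict_mono e" unfolding e_def by (rule strict_mono_enumerate[OF inf])
  have "finite (A \<times> (UNIV :: bool set))" using A by simp
  moreover have "set (mark_repeats (w (e i))) \<subseteq> A \<times> UNIV" for i
    using w[of "e i"] by (fastforce simp: mark_repeats_def)
  ultimately obtain i j where ij: "i < j" "subseq (mark_repeats (w (e i))) (mark_repeats (w (e j)))"
    using higman_finite_alphabet[of "A \<times> (UNIV :: bool set)" "\<lambda>i. mark_repeats (w (e i))"] by blast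
  have eq: "set (w (e i)) = set (w (e j))" "restrict (cnt (w (e i))) A = restrict (cnt (w (e j))) A"
    using e_in[of i] e_in[of j] by (simp_all add: col_def)
  have "cnt (w (e i)) a = cnt (w (e j)) a" if "a \<in> set (w (e i))" for a
    using fun_cong[OF eq(2), of a] that w by (metis restrict_apply' subsetD)
  then have "\<exists>s. congruent_fold l (w (e i)) (w (e j)) s"
    using ij eq by (intro congruent_fold_if_subseq) (auto simp: cnt_def)
  then show ?thesis using strict_monoD[OF e_mono ij(1)] by blast
qed


section \<open>Spans and left ideals\<close>

text \<open>Additive inverses are left out since they arise by scaling with -1. The negation of a
  module record depends on its carrier, whereas the operations named here do not change when the
  carrier is restricted; so the condition passes from a restricted module to the ambient
  one.\<close>

definition lin_closed :: "('k, 'c) ring_scheme \<Rightarrow> ('k, 'm, 'd) module_scheme \<Rightarrow> 'm set \<Rightarrow> bool" where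
  "lin_closed K M H \<longleftrightarrow> H \<subseteq> carrier M \<and> \<zero>\<^bsub>M\<^esub> \<in> H \<and> (\<forall>x\<in>H. \<forall>y\<in>H. x \<oplus>\<^bsub>M\<^esub> y \<in> H) \<and>
    (\<forall>k\<in>carrier K. \<forall>x\<in>H. k \<odot>\<^bsub>M\<^esub> x \<in> H)"

inductive_set lin_span :: "('k, 'c) ring_scheme \<Rightarrow> ('k, 'm, 'd) module_scheme \<Rightarrow> 'm set \<Rightarrow> 'm set"
  for K M S where
  zero: "\<zero>\<^bsub>M\<^esub> \<in> lin_span K M S"
| step: "\<lbrakk>k \<in> carrier K; s \<in> S; x \<in> lin_span K M S\<rbrakk> \<Longrightarrow> k \<odot>\<^bsub>M\<^esub> s \<oplus>\<^bsub>M\<^esub> x \<in> lin_span K M S"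

lemma lin_span_minimal:
  assumes "lin_closed K M H" "S \<subseteq> H"
  shows "lin_span K M S \<subseteq> H"
proof
  fix x assume "x \<in> lin_span K M S"
  then show "x \<in> H" by induction (use assms in \<open>auto simp: lin_closed_def\<close>)
qed

lemma lin_span_mono: "S \<subseteq> T \<Longrightarrow> x \<in> lin_span K M S \<Longrightarrow> x \<in> lin_span K M T"
  by (rotate_tac) (induction rule: lin_span.induct, auto intro: lin_span.intros)

lemma submodule_imp_lin_closed: "submodule H K M \<Longrightarrow> lin_closed K M H"
  unfolding submodule_def submodule_axioms_def subgroup_def lin_closed_def by auto

context left_module
begin

lemma smult_zero_scalar [simp]: "x \<in> carrier M \<Longrightarrow> \<zero>\<^bsub>R\<^esub> \<odot>\<^bsub>M\<^esub> x = \<zero>\<^bsub>M\<^esub>"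
  using smult_l_distr[of "\<zero>\<^bsub>R\<^esub>" "\<zero>\<^bsub>R\<^esub>" x] smult_closed[of "\<zero>\<^bsub>R\<^esub>" x]
  by (metis M.add.r_cancel_one' R.l_zero R.zero_closed)

lemma smult_zero_vector [simp]: "a \<in> carrier R \<Longrightarrow> a \<odot>\<^bsub>M\<^esub> \<zero>\<^bsub>M\<^esub> = \<zero>\<^bsub>M\<^esub>"
  using smult_r_distr[of a "\<zero>\<^bsub>M\<^esub>" "\<zero>\<^bsub>M\<^esub>"] smult_closed[of a "\<zero>\<^bsub>M\<^esub>"]
  by (metis M.add.r_cancel_one' M.l_zero M.zero_closed)

lemma smult_minus_one: "x \<in> carrier M \<Longrightarrow> (\<ominus>\<^bsub>R\<^esub> \<one>\<^bsub>R\<^esub>) \<odot>\<^bsub>M\<^esub> x = \<ominus>\<^bsub>M\<^esub> x"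
  using smult_l_distr[of "\<ominus>\<^bsub>R\<^esub> \<one>\<^bsub>R\<^esub>" "\<one>\<^bsub>R\<^esub>" x] smult_closed[of "\<ominus>\<^bsub>R\<^esub> \<one>\<^bsub>R\<^esub>" x] smult_one[of x]
  by (metis M.minus_equality R.add.inv_closed R.l_neg R.one_closed smult_zero_scalar)

lemma lin_closed_uminus: "lin_closed R M H \<Longrightarrow> x \<in> H \<Longrightarrow> \<ominus>\<^bsub>M\<^esub> x \<in> H"
  using smult_minus_one[of x] unfolding lin_closed_def
  by (metis R.add.inv_closed R.one_closed subsetD)

lemma lin_closed_minus: "lin_closed R M H \<Longrightarrow> x \<in> H \<Longrightarrow> y \<in> H \<Longrightarrow> x \<ominus>\<^bsub>M\<^esub> y \<in> H"
  using lin_closed_uminus[of H y] by (auto simp: a_minus_def lin_closed_def)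

lemma lin_closed_imp_submodule: "lin_closed R M H \<Longrightarrow> submodule H R M"
  using lin_closed_uminus[of H]
  unfolding submodule_def submodule_axioms_def subgroup_def lin_closed_def a_inv_def by auto

lemma lin_span_closed:
  assumes S: "S \<subseteq> carrier M"
  shows "lin_closed R M (lin_span R M S)"
proof -
  have sub: "x \<in> carrier M" if "x \<in> lin_span R M S" for x
    using that by induction (use S smult_closed in auto)
  have "x \<oplus>\<^bsub>M\<^esub> y \<in> lin_span R M S" if "x \<in> lin_span R M S" "y \<in> lin_span R M S" for x y
    using that
  proof (induction x)
    case zero then show ?case using sub by simp
  next
    case (step k s x)
    then have "(k \<odot>\<^bsub>M\<^esub> s \<oplus>\<^bsub>M\<^esub> x) \<oplus>\<^bsub>M\<^esub> y = k \<odot>\<^bsub>M\<^esub> s \<oplus>\<^bsub>M\<^esub> (x \<oplus>\<^bsub>M\<^esub> y)"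
      using sub S smult_closed by (auto intro!: M.a_assoc)
    then show ?case using step lin_span.step[of k R s S "x \<oplus>\<^bsub>M\<^esub> y" M] by simp
  qed
  moreover have "a \<odot>\<^bsub>M\<^esub> x \<in> lin_span R M S" if "a \<in> carrier R" "x \<in> lin_span R M S" for a x
    using that(2)
  proof (induction x)
    case zero then show ?case using that(1) by (simp add: lin_span.zero)
  next
    case (step k s x)
    then have "a \<odot>\<^bsub>M\<^esub> (k \<odot>\<^bsub>M\<^esub> s \<oplus>\<^bsub>M\<^esub> x) = (a \<otimes>\<^bsub>R\<^esub> k) \<odot>\<^bsub>M\<^esub> s \<oplus>\<^bsub>M\<^esub> a \<odot>\<^bsub>M\<^esub> x"
      using sub S smult_closed smult_r_distr smult_assoc1 that(1) by (auto simp: subset_iff)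
    then show ?case using step lin_span.step[of "a \<otimes>\<^bsub>R\<^esub> k" R s S "a \<odot>\<^bsub>M\<^esub> x" M] that(1) by simp
  qed
  ultimately show ?thesis using sub lin_span.zero by (auto simp: lin_closed_def)
qed

lemma lin_span_superset:
  assumes "S \<subseteq> carrier M" "s \<in> S"
  shows "s \<in> lin_span R M S"
  using lin_span.step[OF R.one_closed assms(2) lin_span.zero, of M] assms smult_one by auto

text \<open>Separates off the contribution of one generator. Applied to the largest generator, it
  exhibits a leading coefficient and a remainder in the lower span.\<close>

lemma lin_span_insertE:
  assumes S: "insert a S \<subseteq> carrier M" and x: "x \<in> lin_span R M (insert a S)"
  obtains k y where "k \<in> carrier R" "y \<in> lin_span R M S" "x = k \<odot>\<^bsub>M\<^esub> a \<oplus>\<^bsub>M\<^esub> y"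
proof -
  have sub: "y \<in> carrier M" if "y \<in> lin_span R M S" for y
    using that lin_span_closed[of S] S by (auto simp: lin_closed_def)
  from x have "\<exists>k\<in>carrier R. \<exists>y\<in>lin_span R M S. x = k \<odot>\<^bsub>M\<^esub> a \<oplus>\<^bsub>M\<^esub> y"
  proof induction
    case zero
    then show ?case using S by (intro bexI[of _ "\<zero>\<^bsub>R\<^esub>"] bexI[of _ "\<zero>\<^bsub>M\<^esub>"]) (auto intro: lin_span.zero)
  next
    case (step k s x)
    then obtain l y where ly: "l \<in> carrier R" "y \<in> lin_span R M S" "x = l \<odot>\<^bsub>M\<^esub> a \<oplus>\<^bsub>M\<^esub> y" by auto
    have in_carrier: "a \<in> carrier M" "s \<in> carrier M" "y \<in> carrier M" using S step ly sub by auto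
    show ?case
    proof (cases "s = a")
      case True
      then have "k \<odot>\<^bsub>M\<^esub> s \<oplus>\<^bsub>M\<^esub> x = (k \<oplus>\<^bsub>R\<^esub> l) \<odot>\<^bsub>M\<^esub> a \<oplus>\<^bsub>M\<^esub> y"
        using ly step in_carrier smult_closed by (simp add: smult_l_distr M.a_assoc)
      then show ?thesis using ly step R.add.m_closed by blast
    next
      case False
      have "k \<odot>\<^bsub>M\<^esub> s \<oplus>\<^bsub>M\<^esub> x = l \<odot>\<^bsub>M\<^esub> a \<oplus>\<^bsub>M\<^esub> (k \<odot>\<^bsub>M\<^esub> s \<oplus>\<^bsub>M\<^esub> y)"
        using ly step in_carrier smult_closed by (simp add: M.a_lcomm)
      moreover have "k \<odot>\<^bsub>M\<^esub> s \<oplus>\<^bsub>M\<^esub> y \<in> lin_span R M S" using False step ly by (auto intro: lin_span.step)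
      ultimately show ?thesis using ly by blast
    qed
  qed
  then show thesis using that by blast
qed

end

lemma linear_maps_lin_span:
  assumes f: "f \<in> linear_maps K V W" and V: "left_module K V" and W: "left_module K W"
    and S: "S \<subseteq> carrier V" and x: "x \<in> lin_span K V S"
  shows "f x \<in> lin_span K W (f ` S)"
proof -
  interpret V: left_module K V by (rule V)
  interpret W: left_module K W by (rule W)
  have f_in: "\<And>v. v \<in> carrier V \<Longrightarrow> f v \<in> carrier W"
    and f_add: "\<And>v w. v \<in> carrier V \<Longrightarrow> w \<in> carrier V \<Longrightarrow> f (v \<oplus>\<^bsub>V\<^esub> w) = f v \<oplus>\<^bsub>W\<^esub> f w"
    and f_smult: "\<And>k v. k \<in> carrier K \<Longrightarrow> v \<in> carrier V \<Longrightarrow> f (k \<odot>\<^bsub>V\<^esub> v) = k \<odot>\<^bsub>W\<^esub> f v"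
    using f by (auto simp: linear_maps_def)
  have sub: "y \<in> carrier V" if "y \<in> lin_span K V S" for y
    using that V.lin_span_closed[OF S] by (auto simp: lin_closed_def)
  from x show ?thesis
  proof induction
    case zero
    have "f \<zero>\<^bsub>V\<^esub> = f (\<zero>\<^bsub>K\<^esub> \<odot>\<^bsub>V\<^esub> \<zero>\<^bsub>V\<^esub>)" by simp
    also have "\<dots> = \<zero>\<^bsub>W\<^esub>" by (subst f_smult) (auto simp: f_in)
    finally show ?case by (simp add: lin_span.zero)
  next
    case (step k s x)
    then have "f (k \<odot>\<^bsub>V\<^esub> s \<oplus>\<^bsub>V\<^esub> x) = k \<odot>\<^bsub>W\<^esub> f s \<oplus>\<^bsub>W\<^esub> f x"
      using S sub V.smult_closed by (simp add: f_add f_smult subset_iff)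
    then show ?case using step by (auto intro: lin_span.step)
  qed
qed

lemma (in ring) left_module_self: "left_module R (self_module R)"
proof -
  have "abelian_group (self_module R)"
    by (rule abelian_groupI) (auto simp: self_module_def a_assoc intro: a_comm add.l_inv_ex)
  then show ?thesis
    unfolding left_module_def left_module_axioms_def
    using ring_axioms by (auto simp: self_module_def l_distr r_distr m_assoc)
qed

text \<open>The union of the chain is a left ideal, and its finitely many generators already lie in
  a single member.\<close>

lemma (in left_noetherian_ring) left_ideal_chain_stabilizes:
  assumes I: "\<And>n. submodule (I n) K (self_module K)" and mono: "\<And>n. I n \<subseteq> I (Suc n)"
  shows "\<exists>n. I (Suc n) = I n"
proof -
  interpret self: left_module K "self_module K" by (rule left_module_self)
  have le: "I m \<subseteq> I n" if "m \<le> n" for m n using lift_Suc_mono_le[of I, OF mono that] .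
  have closed: "lin_closed K (self_module K) (I n)" for n by (rule submodule_imp_lin_closed[OF I])
  have "lin_closed K (self_module K) (\<Union>n. I n)"
    unfolding lin_closed_def
  proof (intro conjI ballI)
    fix x y assume "x \<in> (\<Union>n. I n)" "y \<in> (\<Union>n. I n)"
    then obtain m n where "x \<in> I m" "y \<in> I n" by auto
    then have "x \<in> I (max m n)" "y \<in> I (max m n)" using le[of m "max m n"] le[of n "max m n"] by auto
    then show "x \<oplus>\<^bsub>self_module K\<^esub> y \<in> (\<Union>n. I n)" using closed[of "max m n"] by (auto simp: lin_closed_def)
  next
    show "(\<Union>n. I n) \<subseteq> carrier (self_module K)" using closed unfolding lin_closed_def by blast
    show "\<zero>\<^bsub>self_module K\<^esub> \<in> (\<Union>n. I n)" using closed unfolding lin_closed_def by blast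
    show "k \<odot>\<^bsub>self_module K\<^esub> x \<in> (\<Union>n. I n)" if "k \<in> carrier K" "x \<in> (\<Union>n. I n)" for k x
      using closed that unfolding lin_closed_def by blast
  qed
  from left_ideals_finitely_generated[OF self.lin_closed_imp_submodule[OF this]]
  obtain A where A: "finite A" "A \<subseteq> (\<Union>n. I n)"
    and min: "\<forall>J. submodule J K (self_module K) \<and> A \<subseteq> J \<longrightarrow> (\<Union>n. I n) \<subseteq> J" by (elim exE conjE)
  from A have "\<exists>n. A \<subseteq> I n"
  proof (induction A)
    case (insert a A)
    then obtain m n where "a \<in> I m" "A \<subseteq> I n" by auto
    then have "insert a A \<subseteq> I (max m n)" using le[of m "max m n"] le[of n "max m n"] by auto
    then show ?case by blast
  qed auto
  then obtain n where "A \<subseteq> I n" by blast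
  with min I[of n] have "(\<Union>n. I n) \<subseteq> I n" by (simp only: simp_thms)
  then have "I (Suc n) \<subseteq> I n" by blast
  then show ?thesis using mono by blast
qed

section \<open>Good sequences: finite bases and infinite chains\<close>

lemma finite_basis_if_good_sequences:
  assumes good: "\<And>t :: nat \<Rightarrow> 'a. (\<And>n. t n \<in> T) \<Longrightarrow> \<exists>i j. i < j \<and> P (t i) (t j)"
  shows "\<exists>B. finite B \<and> B \<subseteq> T \<and> (\<forall>t\<in>T. \<exists>b\<in>B. P b t)"
proof (rule ccontr)
  assume "\<not> ?thesis"
  then have ex: "\<exists>t. t \<in> T \<and> (\<forall>b\<in>B. \<not> P b t)" if "finite B" "B \<subseteq> T" for B using that by auto
  \<comment> \<open>An element not covered by the finite set chosen so far; iterating this choice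
    produces a sequence without a good pair.\<close>
  define c where "c B = (SOME t. t \<in> T \<and> (\<forall>b\<in>B. \<not> P b t))" for B
  have c: "c B \<in> T \<and> (\<forall>b\<in>B. \<not> P b (c B))" if "finite B" "B \<subseteq> T" for B
    unfolding c_def by (rule someI_ex[OF ex[OF that]])
  define B where "B = rec_nat {} (\<lambda>_ B. insert (c B) B)"
  have B: "B (Suc n) = insert (c (B n)) (B n)" for n by (simp add: B_def)
  have fin: "finite (B n) \<and> B n \<subseteq> T" for n
    by (induction n) (use c in \<open>auto simp: B_def\<close>)
  have mem: "c (B i) \<in> B j" if "i < j" for i j
    using that by (induction j) (auto simp: B less_Suc_eq)
  have "\<exists>i j. i < j \<and> P (c (B i)) (c (B j))" by (rule good) (use c fin in blast)
  then obtain i j where "i < j" "P (c (B i)) (c (B j))" by blast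
  then show False using c[of "B j"] fin[of j] mem[of i j] by blast
qed

text \<open>Ramsey's theorem: colour a pair of indices by whether \<open>P\<close> holds from the
  smaller to the larger, which \<open>Min\<close> and \<open>Max\<close> recover from the unordered
  pair. A homogeneous set cannot have the negative colour, because its own enumeration is a
  subsequence and contains a good pair.\<close>

lemma infinite_chain_if_good_sequences:
  fixes t :: "nat \<Rightarrow> 'a"
  assumes good: "\<And>e :: nat \<Rightarrow> nat. strict_mono e \<Longrightarrow> \<exists>i j. i < j \<and> P (t (e i)) (t (e j))"
  shows "\<exists>e :: nat \<Rightarrow> nat. strict_mono e \<and> (\<forall>i j. i < j \<longrightarrow> P (t (e i)) (t (e j)))"
proof -
  define col :: "nat set \<Rightarrow> nat" where "col X = (if P (t (Min X)) (t (Max X)) then 0 else 1)" for X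
  have "\<exists>Y c. Y \<subseteq> (UNIV :: nat set) \<and> infinite Y \<and> c < 2 \<and> (\<forall>x\<in>Y. \<forall>y\<in>Y. x \<noteq> y \<longrightarrow> col {x, y} = c)"
    by (rule Ramsey2) (auto simp: col_def)
  then obtain Y c where Y: "infinite Y" and c: "\<And>x y. x \<in> Y \<Longrightarrow> y \<in> Y \<Longrightarrow> x \<noteq> y \<Longrightarrow> col {x, y} = c" by auto
  define e where "e = enumerate Y"
  have e: "strict_mono e" "\<And>n. e n \<in> Y"
    using Y by (auto simp: e_def strict_mono_enumerate enumerate_in_set)
  have col: "col {e i, e j} = c" and eq: "col {e i, e j} = (if P (t (e i)) (t (e j)) then 0 else 1)"
    if "i < j" for i j
  proof -
    have "e i < e j" using e(1) that by (simp add: strict_mono_less)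
    then show "col {e i, e j} = c" "col {e i, e j} = (if P (t (e i)) (t (e j)) then 0 else 1)"
      using c[OF e(2) e(2), of i j] by (simp_all add: col_def)
  qed
  obtain i j where "i < j" "P (t (e i)) (t (e j))" using good[OF e(1)] by blast
  then have "c = 0" using col[of i j] eq[of i j] by simp
  then show ?thesis using e(1) col eq by (metis zero_neq_one)
qed


section \<open>Groebner bases for category modules\<close>

text \<open>
  A generator of the value at \<open>Y\<close> is a pair of a given generator \<open>s = (X, x)\<close> and a morphism \<open>f : X \<rightarrow> Y\<close>; it stands
  for the element \<open>M(f)(x)\<close>.
\<close>
locale groebner_cmodule = cmodule C K M + coeff: left_noetherian_ring K
  for C :: "('o, 'a) category_data" and K :: "'k ring" and M :: "('o, 'a, 'k, 'm) cmodule_data" +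
  fixes S :: "('o \<times> 'm) set" and key :: "'o \<Rightarrow> ('o \<times> 'm) \<times> 'a \<Rightarrow> 'l :: linorder"
  assumes finite_S: "finite S" and S: "S \<subseteq> (SIGMA X : Ob C. carrier (obj_map M X))"
    and S_generates: "\<And>N Y. csubmodule C K M N \<Longrightarrow> (\<And>X x. (X, x) \<in> S \<Longrightarrow> x \<in> N X) \<Longrightarrow> Y \<in> Ob C \<Longrightarrow>
      N Y = carrier (obj_map M Y)"
    and finite_Mor: "\<And>X x Y. (X, x) \<in> S \<Longrightarrow> Y \<in> Ob C \<Longrightarrow> finite (Mor C X Y)"
    and key_inj: "\<And>Y. Y \<in> Ob C \<Longrightarrow> inj_on (key Y) {(s, f). s \<in> S \<and> f \<in> Mor C (fst s) Y}"
    and good: "\<And>(Y :: nat \<Rightarrow> 'o) s f. (\<And>n. Y n \<in> Ob C \<and> s n \<in> S \<and> f n \<in> Mor C (fst (s n)) (Y n)) \<Longrightarrow>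
      \<exists>i j g. i < j \<and> g \<in> Mor C (Y i) (Y j) \<and> s j = s i \<and> f j = Cmp C (fst (s i)) (Y i) (Y j) g (f i) \<and>
        (\<forall>s'\<in>S. \<forall>f'\<in>Mor C (fst s') (Y i). key (Y i) (s', f') < key (Y i) (s i, f i) \<longrightarrow>
          key (Y j) (s', Cmp C (fst s') (Y i) (Y j) g f') < key (Y j) (s j, f j))"
begin

section \<open>Leading coefficients with respect to the order on generators\<close>

definition gens :: "'o \<Rightarrow> (('o \<times> 'm) \<times> 'a) set" where
  "gens Y = {(s, f). s \<in> S \<and> f \<in> Mor C (fst s) Y}"

definition val :: "'o \<Rightarrow> ('o \<times> 'm) \<times> 'a \<Rightarrow> 'm" where
  "val Y t = mor_map M (fst (fst t)) Y (snd t) (snd (fst t))"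

definition act :: "'o \<Rightarrow> 'o \<Rightarrow> 'a \<Rightarrow> ('o \<times> 'm) \<times> 'a \<Rightarrow> ('o \<times> 'm) \<times> 'a" where
  "act Y Z g t = (fst t, Cmp C (fst (fst t)) Y Z g (snd t))"

definition below :: "'o \<Rightarrow> ('o \<times> 'm) \<times> 'a \<Rightarrow> (('o \<times> 'm) \<times> 'a) set" where
  "below Y t = {t' \<in> gens Y. key Y t' < key Y t}"

definition lower :: "'o \<Rightarrow> ('o \<times> 'm) \<times> 'a \<Rightarrow> 'm set" where
  "lower Y t = lin_span K (obj_map M Y) (val Y ` below Y t)"

text \<open>A relation between \<open>k\<close> and some element of \<open>N Y\<close>, not a
  function of that element: the generators may be linearly dependent, so one element can contribute
  several coefficients at the same generator.\<close>

definition leading :: "('o \<Rightarrow> 'm set) \<Rightarrow> 'o \<Rightarrow> ('o \<times> 'm) \<times> 'a \<Rightarrow> 'k set" where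
  "leading N Y t = {k \<in> carrier K. \<exists>n\<in>N Y. \<exists>z\<in>lower Y t. n = k \<odot>\<^bsub>obj_map M Y\<^esub> val Y t \<oplus>\<^bsub>obj_map M Y\<^esub> z}"

text \<open>Submodules of \<open>M\<close> and submodules of a restriction of \<open>M\<close> both
  satisfy this, so leading ideals of either are formed inside \<open>M\<close> and can be
  compared.\<close>

definition stable :: "('o \<Rightarrow> 'm set) \<Rightarrow> bool" where
  "stable N \<longleftrightarrow> (\<forall>Y\<in>Ob C. lin_closed K (obj_map M Y) (N Y)) \<and>
    (\<forall>Y\<in>Ob C. \<forall>Z\<in>Ob C. \<forall>g\<in>Mor C Y Z. mor_map M Y Z g ` N Y \<subseteq> N Z)"

text \<open>Besides carrying t to u, the morphism has to keep the generators below t below u. This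
  is what moves a lower remainder into a lower remainder.\<close>

definition divides :: "'o \<times> (('o \<times> 'm) \<times> 'a) \<Rightarrow> 'o \<times> (('o \<times> 'm) \<times> 'a) \<Rightarrow> bool" where
  "divides = (\<lambda>(Y, t) (Z, u). \<exists>g\<in>Mor C Y Z. u = act Y Z g t \<and> act Y Z g ` below Y t \<subseteq> below Z u)"

lemma lmod: "Y \<in> Ob C \<Longrightarrow> left_module K (obj_map M Y)"
  by (rule obj_map_module)

lemma gens_Ob: "t \<in> gens Y \<Longrightarrow> fst (fst t) \<in> Ob C \<and> snd (fst t) \<in> carrier (obj_map M (fst (fst t))) \<and>
    snd t \<in> Mor C (fst (fst t)) Y"
  using S by (auto simp: gens_def)

lemma mor_closed: "\<lbrakk>Y \<in> Ob C; Z \<in> Ob C; g \<in> Mor C Y Z; x \<in> carrier (obj_map M Y)\<rbrakk> \<Longrightarrow>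
    mor_map M Y Z g x \<in> carrier (obj_map M Z)"
  using mor_map_linear[of Y Z g] by (auto simp: linear_maps_def)

lemma val_closed: "Y \<in> Ob C \<Longrightarrow> t \<in> gens Y \<Longrightarrow> val Y t \<in> carrier (obj_map M Y)"
  using gens_Ob[of t Y] mor_closed by (auto simp: val_def)

lemma act_gens: "\<lbrakk>Y \<in> Ob C; Z \<in> Ob C; g \<in> Mor C Y Z; t \<in> gens Y\<rbrakk> \<Longrightarrow> act Y Z g t \<in> gens Z"
  using gens_Ob[of t Y] Cmp_closed[of "fst (fst t)" Y Z "snd t" g] by (auto simp: act_def gens_def)

lemma val_act: "\<lbrakk>Y \<in> Ob C; Z \<in> Ob C; g \<in> Mor C Y Z; t \<in> gens Y\<rbrakk> \<Longrightarrow>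
    val Z (act Y Z g t) = mor_map M Y Z g (val Y t)"
  using gens_Ob[of t Y] mor_map_Cmp by (auto simp: act_def val_def)

lemma gens_closed: "Y \<in> Ob C \<Longrightarrow> val Y ` gens Y \<subseteq> carrier (obj_map M Y)"
  using val_closed by blast

lemma below_closed: "Y \<in> Ob C \<Longrightarrow> val Y ` below Y t \<subseteq> carrier (obj_map M Y)"
  using val_closed by (auto simp: below_def)

lemma lower_lin_closed: "Y \<in> Ob C \<Longrightarrow> lin_closed K (obj_map M Y) (lower Y t)"
  unfolding lower_def using left_module.lin_span_closed[OF lmod below_closed] by blast

lemma stable_if_csubmodule: "csubmodule C K M N \<Longrightarrow> stable N"
  by (auto simp: csubmodule_def stable_def intro: submodule_imp_lin_closed)

lemma stable_if_csubmodule_restrict: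
  assumes N: "stable N" and N': "csubmodule C K (restrict_cmodule M N) N'"
  shows "stable N'" and "Y \<in> Ob C \<Longrightarrow> N' Y \<subseteq> N Y"
proof -
  have sub: "lin_closed K ((obj_map M Y)\<lparr>carrier := N Y\<rparr>) (N' Y)" if "Y \<in> Ob C" for Y
    using N' that by (auto simp: csubmodule_def restrict_cmodule_def intro: submodule_imp_lin_closed)
  show le: "N' Y \<subseteq> N Y" if "Y \<in> Ob C" for Y
    using sub[OF that] by (auto simp: lin_closed_def)
  have "lin_closed K (obj_map M Y) (N' Y)" if "Y \<in> Ob C" for Y
  proof -
    have "N Y \<subseteq> carrier (obj_map M Y)" using N that by (simp add: lin_closed_def stable_def)
    then show ?thesis using sub[OF that] le[OF that] by (auto simp: lin_closed_def)
  qed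
  then show "stable N'"
    using N' by (auto simp: stable_def csubmodule_def restrict_cmodule_def)
qed

text \<open>The spans of the generators form a submodule because morphisms permit composition with
  generators, and a given generator (X, x) is its own value at the identity. Hence this submodule is
  everything.\<close>

lemma carrier_eq_span:
  assumes Y: "Y \<in> Ob C"
  shows "carrier (obj_map M Y) = lin_span K (obj_map M Y) (val Y ` gens Y)"
proof -
  let ?N = "\<lambda>Y. lin_span K (obj_map M Y) (val Y ` gens Y)"
  have "csubmodule C K M ?N"
    unfolding csubmodule_def
  proof (intro conjI ballI)
    show "submodule (?N Y) K (obj_map M Y)" if "Y \<in> Ob C" for Y
      using left_module.lin_closed_imp_submodule[OF lmod left_module.lin_span_closed[OF lmod gens_closed]] that
      by blast
    fix Y Z g assume g: "Y \<in> Ob C" "Z \<in> Ob C" "g \<in> Mor C Y Z"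
    show "mor_map M Y Z g ` ?N Y \<subseteq> ?N Z"
    proof
      fix y assume "y \<in> mor_map M Y Z g ` ?N Y"
      then obtain x where x: "x \<in> ?N Y" "y = mor_map M Y Z g x" by auto
      have "y \<in> lin_span K (obj_map M Z) (mor_map M Y Z g ` val Y ` gens Y)"
        unfolding x(2) by (rule linear_maps_lin_span[OF mor_map_linear lmod lmod gens_closed x(1)]) (use g in auto)
      moreover have "mor_map M Y Z g ` val Y ` gens Y \<subseteq> val Z ` gens Z"
        using act_gens[OF g] val_act[OF g] by (auto simp: image_iff) metis
      ultimately show "y \<in> ?N Z" using lin_span_mono by metis
    qed
  qed
  moreover have "x \<in> ?N X" if "(X, x) \<in> S" for X x
  proof -
    have X: "X \<in> Ob C" "x \<in> carrier (obj_map M X)" using S that by auto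
    then have t: "((X, x), Idt C X) \<in> gens X" using that Idt_closed by (auto simp: gens_def)
    have "val X ((X, x), Idt C X) = x" using X by (simp add: val_def mor_map_Idt)
    then show ?thesis
      using left_module.lin_span_superset[OF lmod[OF X(1)] gens_closed[OF X(1)]] t by (metis image_eqI)
  qed
  ultimately show ?thesis using S_generates[of ?N Y] Y by simp
qed

lemma leading_left_ideal:
  assumes N: "stable N" and Y: "Y \<in> Ob C" and t: "t \<in> gens Y"
  shows "submodule (leading N Y t) K (self_module K)"
proof -
  interpret self: left_module K "self_module K" by (rule coeff.left_module_self)
  interpret Y: left_module K "obj_map M Y" by (rule lmod[OF Y])
  have NY: "lin_closed K (obj_map M Y) (N Y)" using N Y by (simp add: stable_def)
  note low = lower_lin_closed[OF Y, of t]
  have v: "val Y t \<in> carrier (obj_map M Y)" by (rule val_closed[OF Y t])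
  have low_in: "z \<in> carrier (obj_map M Y)" if "z \<in> lower Y t" for z
    using low that by (auto simp: lin_closed_def)
  have "lin_closed K (self_module K) (leading N Y t)"
    unfolding lin_closed_def
  proof (intro conjI ballI)
    show "leading N Y t \<subseteq> carrier (self_module K)" by (auto simp: leading_def self_module_def)
    have "\<zero>\<^bsub>obj_map M Y\<^esub> \<in> N Y" "\<zero>\<^bsub>obj_map M Y\<^esub> \<in> lower Y t"
      using NY low by (auto simp: lin_closed_def)
    moreover have "\<zero>\<^bsub>obj_map M Y\<^esub> = \<zero>\<^bsub>K\<^esub> \<odot>\<^bsub>obj_map M Y\<^esub> val Y t \<oplus>\<^bsub>obj_map M Y\<^esub> \<zero>\<^bsub>obj_map M Y\<^esub>"
      using v by simp
    ultimately show "\<zero>\<^bsub>self_module K\<^esub> \<in> leading N Y t"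
      unfolding leading_def by (auto simp: self_module_def)
  next
    fix k l assume "k \<in> leading N Y t" "l \<in> leading N Y t"
    then obtain n n' z z' where k: "k \<in> carrier K" "n \<in> N Y" "z \<in> lower Y t"
        "n = k \<odot>\<^bsub>obj_map M Y\<^esub> val Y t \<oplus>\<^bsub>obj_map M Y\<^esub> z"
      and l: "l \<in> carrier K" "n' \<in> N Y" "z' \<in> lower Y t"
        "n' = l \<odot>\<^bsub>obj_map M Y\<^esub> val Y t \<oplus>\<^bsub>obj_map M Y\<^esub> z'"
      by (auto simp: leading_def)
    have "n \<oplus>\<^bsub>obj_map M Y\<^esub> n' \<in> N Y" "z \<oplus>\<^bsub>obj_map M Y\<^esub> z' \<in> lower Y t"
      using NY low k l by (auto simp: lin_closed_def)
    moreover have "n \<oplus>\<^bsub>obj_map M Y\<^esub> n' =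
        (k \<oplus>\<^bsub>K\<^esub> l) \<odot>\<^bsub>obj_map M Y\<^esub> val Y t \<oplus>\<^bsub>obj_map M Y\<^esub> (z \<oplus>\<^bsub>obj_map M Y\<^esub> z')"
      unfolding k(4) l(4) using k l v low_in Y.smult_closed
      by (simp add: Y.smult_l_distr Y.M.a_assoc Y.M.a_lcomm)
    ultimately show "k \<oplus>\<^bsub>self_module K\<^esub> l \<in> leading N Y t"
      using k l unfolding leading_def by (auto simp: self_module_def)
  next
    fix a k assume a: "a \<in> carrier K" and "k \<in> leading N Y t"
    then obtain n z where k: "k \<in> carrier K" "n \<in> N Y" "z \<in> lower Y t"
        "n = k \<odot>\<^bsub>obj_map M Y\<^esub> val Y t \<oplus>\<^bsub>obj_map M Y\<^esub> z"
      by (auto simp: leading_def)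
    have "a \<odot>\<^bsub>obj_map M Y\<^esub> n \<in> N Y" "a \<odot>\<^bsub>obj_map M Y\<^esub> z \<in> lower Y t"
      using NY low k a by (auto simp: lin_closed_def)
    moreover have "a \<odot>\<^bsub>obj_map M Y\<^esub> n =
        (a \<otimes>\<^bsub>K\<^esub> k) \<odot>\<^bsub>obj_map M Y\<^esub> val Y t \<oplus>\<^bsub>obj_map M Y\<^esub> (a \<odot>\<^bsub>obj_map M Y\<^esub> z)"
      unfolding k(4) using k a v low_in Y.smult_closed by (simp add: Y.smult_r_distr Y.smult_assoc1)
    ultimately show "a \<odot>\<^bsub>self_module K\<^esub> k \<in> leading N Y t"
      using k a unfolding leading_def by (auto simp: self_module_def)
  qed
  then show ?thesis by (rule self.lin_closed_imp_submodule)
qed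

text \<open>Applying the morphism of the division to \<open>k \<odot> val Y t \<oplus> z\<close>
  keeps the coefficient k, turns \<open>val Y t\<close> into \<open>val Z u\<close>, and leaves the
  image of z in the lower span.\<close>

lemma leading_mono:
  assumes N: "stable N" and Y: "Y \<in> Ob C" and Z: "Z \<in> Ob C" and t: "t \<in> gens Y"
    and div: "divides (Y, t) (Z, u)"
  shows "leading N Y t \<subseteq> leading N Z u"
proof
  from div obtain g where g: "g \<in> Mor C Y Z" and u: "u = act Y Z g t"
    and le: "act Y Z g ` below Y t \<subseteq> below Z u" by (auto simp: divides_def)
  interpret Y: left_module K "obj_map M Y" by (rule lmod[OF Y])
  fix k assume "k \<in> leading N Y t"
  then obtain n z where k: "k \<in> carrier K" "n \<in> N Y" "z \<in> lower Y t"
      "n = k \<odot>\<^bsub>obj_map M Y\<^esub> val Y t \<oplus>\<^bsub>obj_map M Y\<^esub> z"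
    by (auto simp: leading_def)
  let ?g = "mor_map M Y Z g"
  have z: "z \<in> carrier (obj_map M Y)" using k(3) lower_lin_closed[OF Y, of t] by (auto simp: lin_closed_def)
  note lin = mor_map_linear[OF Y Z g]
  have "?g n \<in> N Z" using N Y Z g k(2) unfolding stable_def by blast
  moreover have "?g n = k \<odot>\<^bsub>obj_map M Z\<^esub> val Z u \<oplus>\<^bsub>obj_map M Z\<^esub> ?g z"
    unfolding k(4) u val_act[OF Y Z g t] using lin k(1) z val_closed[OF Y t] Y.smult_closed
    by (simp add: linear_maps_def)
  moreover have "?g z \<in> lower Z u"
  proof -
    have "?g z \<in> lin_span K (obj_map M Z) (?g ` val Y ` below Y t)"
      using linear_maps_lin_span[OF lin lmod[OF Y] lmod[OF Z] below_closed[OF Y]] k(3) by (simp add: lower_def)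
    moreover have "?g ` val Y ` below Y t \<subseteq> val Z ` below Z u"
    proof
      fix y assume "y \<in> ?g ` val Y ` below Y t"
      then obtain t' where t': "t' \<in> below Y t" "y = ?g (val Y t')" by auto
      then have "y = val Z (act Y Z g t')" using val_act[OF Y Z g, of t'] by (simp add: below_def)
      then show "y \<in> val Z ` below Z u" using le t' by blast
    qed
    ultimately show ?thesis unfolding lower_def using lin_span_mono by metis
  qed
  ultimately show "k \<in> leading N Z u" using k(1) unfolding leading_def by blast
qed

text \<open>
  Induction along the order of the generators: subtracting an element of \<open>N'\<close> with the same leading coefficient
  moves an element of \<open>N\<close> into the span of smaller generators.
\<close>
lemma subset_if_leading_subset:
  assumes N: "stable N" and N': "stable N'" and le: "\<And>Y. Y \<in> Ob C \<Longrightarrow> N' Y \<subseteq> N Y"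
    and lead: "\<And>t. t \<in> gens Y \<Longrightarrow> leading N Y t \<subseteq> leading N' Y t" and Y: "Y \<in> Ob C"
  shows "N Y \<subseteq> N' Y"
proof -
  interpret Y: left_module K "obj_map M Y" by (rule lmod[OF Y])
  have NY: "lin_closed K (obj_map M Y) (N Y)" and NY': "lin_closed K (obj_map M Y) (N' Y)"
    using N N' Y by (auto simp: stable_def)
  have fin: "finite (gens Y)"
  proof (rule finite_subset)
    show "gens Y \<subseteq> (SIGMA s : S. Mor C (fst s) Y)" by (auto simp: gens_def)
    show "finite (SIGMA s : S. Mor C (fst s) Y)"
      using finite_S finite_Mor[OF _ Y] by (intro finite_SigmaI) (auto simp: prod_eq_iff)
  qed
  have inj: "inj_on (key Y) (gens Y)" using key_inj[OF Y] by (simp add: gens_def)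
  define span where "span A = lin_span K (obj_map M Y) (val Y ` {t \<in> gens Y. key Y t \<in> A})" for A
  \<comment> \<open>\<open>A\<close> runs through down-closed sets of keys, each obtained from the
    previous one by adding a new maximum b. Down-closedness makes the previous set consist of all
    keys below b, and injectivity of \<open>key Y\<close> leaves a single generator with key
    b.\<close>
  have "A \<subseteq> key Y ` gens Y \<longrightarrow> (\<forall>t\<in>gens Y. \<forall>a\<in>A. key Y t \<le> a \<longrightarrow> key Y t \<in> A) \<longrightarrow> N Y \<inter> span A \<subseteq> N' Y"
    if "finite A" for A
    using that
  proof (induction rule: finite_linorder_max_induct)
    case empty
    have "span {} \<subseteq> {\<zero>\<^bsub>obj_map M Y\<^esub>}"
      unfolding span_def by (rule lin_span_minimal) (auto simp: lin_closed_def)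
    then show ?case using NY' by (auto simp: lin_closed_def)
  next
    case (insert b A)
    show ?case
    proof (intro impI subsetI)
      fix n assume sub: "insert b A \<subseteq> key Y ` gens Y"
        and down: "\<forall>t\<in>gens Y. \<forall>a\<in>insert b A. key Y t \<le> a \<longrightarrow> key Y t \<in> insert b A"
        and n: "n \<in> N Y \<inter> span (insert b A)"
      from sub obtain t where t: "t \<in> gens Y" "b = key Y t" by auto
      have eqA: "{u \<in> gens Y. key Y u \<in> A} = below Y t"
        using insert.hyps down t by (fastforce simp: below_def)
      have "{u \<in> gens Y. key Y u \<in> insert b A} = insert t {u \<in> gens Y. key Y u \<in> A}"
        using t inj by (auto dest: inj_onD)
      then have span: "span A = lower Y t" "span (insert b A) = lin_span K (obj_map M Y) (insert (val Y t) (val Y ` below Y t))"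
        using eqA by (simp_all add: span_def lower_def)
      have IH: "N Y \<inter> lower Y t \<subseteq> N' Y"
        unfolding span(1)[symmetric]
      proof (rule insert.IH[rule_format])
        show "A \<subseteq> key Y ` gens Y" using sub by simp
        fix u a assume "u \<in> gens Y" "a \<in> A" "key Y u \<le> a"
        then show "key Y u \<in> A" using down insert.hyps by fastforce
      qed
      have v: "val Y t \<in> carrier (obj_map M Y)" by (rule val_closed[OF Y t(1)])
      have "insert (val Y t) (val Y ` below Y t) \<subseteq> carrier (obj_map M Y)" using v below_closed[OF Y] by auto
      from Y.lin_span_insertE[OF this] n obtain k z where k: "k \<in> carrier K" "z \<in> lower Y t"
        and n_eq: "n = k \<odot>\<^bsub>obj_map M Y\<^esub> val Y t \<oplus>\<^bsub>obj_map M Y\<^esub> z"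
        unfolding span(2) lower_def by blast
      have "k \<in> leading N Y t" using k n n_eq unfolding leading_def by blast
      then have "k \<in> leading N' Y t" using lead t by blast
      then obtain n' z' where n': "n' \<in> N' Y" "z' \<in> lower Y t"
        and n'_eq: "n' = k \<odot>\<^bsub>obj_map M Y\<^esub> val Y t \<oplus>\<^bsub>obj_map M Y\<^esub> z'"
        unfolding leading_def by blast
      have in_carrier: "z \<in> carrier (obj_map M Y)" "z' \<in> carrier (obj_map M Y)"
          "k \<odot>\<^bsub>obj_map M Y\<^esub> val Y t \<in> carrier (obj_map M Y)"
        using k n' lower_lin_closed[OF Y, of t] v Y.smult_closed by (auto simp: lin_closed_def)
      have eq: "n = (z \<ominus>\<^bsub>obj_map M Y\<^esub> z') \<oplus>\<^bsub>obj_map M Y\<^esub> n'"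
      proof -
        let ?v = "k \<odot>\<^bsub>obj_map M Y\<^esub> val Y t"
        have "?v \<oplus>\<^bsub>obj_map M Y\<^esub> z' = z' \<oplus>\<^bsub>obj_map M Y\<^esub> ?v" using in_carrier by (simp add: Y.M.a_comm)
        then show ?thesis
          unfolding n_eq n'_eq using in_carrier
          by (simp add: a_minus_def Y.M.a_assoc Y.M.r_neg1) (simp add: Y.M.a_comm)
      qed
      have "n \<ominus>\<^bsub>obj_map M Y\<^esub> n' = z \<ominus>\<^bsub>obj_map M Y\<^esub> z'"
        unfolding eq using in_carrier n' NY'
        by (auto simp: lin_closed_def a_minus_def Y.M.a_assoc Y.M.r_neg subset_iff)
      moreover have "n \<ominus>\<^bsub>obj_map M Y\<^esub> n' \<in> N Y"
        using Y.lin_closed_minus[OF NY] n n' le[OF Y] by blast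
      moreover have "z \<ominus>\<^bsub>obj_map M Y\<^esub> z' \<in> lower Y t"
        using Y.lin_closed_minus[OF lower_lin_closed[OF Y]] k n' by blast
      ultimately have "z \<ominus>\<^bsub>obj_map M Y\<^esub> z' \<in> N' Y" using IH by auto
      then show "n \<in> N' Y" unfolding eq using NY' n' by (auto simp: lin_closed_def)
    qed
  qed
  from this[of "key Y ` gens Y"] have "N Y \<inter> span (key Y ` gens Y) \<subseteq> N' Y" using fin by auto
  moreover have "{t \<in> gens Y. key Y t \<in> key Y ` gens Y} = gens Y" by auto
  ultimately show ?thesis
    using NY carrier_eq_span[OF Y] by (auto simp: span_def lin_closed_def)
qed

text \<open>Every subsequence has a dividing pair, so Ramsey yields an infinite chain of divisions.
  Leading ideals increase along it and must repeat at consecutive terms.\<close>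

lemma good_leading:
  assumes N: "stable N" and t: "\<And>n :: nat. fst (t n) \<in> Ob C \<and> snd (t n) \<in> gens (fst (t n))"
  shows "\<exists>i j. i < j \<and> divides (t i) (t j) \<and> leading N (fst (t i)) (snd (t i)) = leading N (fst (t j)) (snd (t j))"
proof -
  have "\<exists>i j. i < j \<and> divides (t (e i)) (t (e j))" for e :: "nat \<Rightarrow> nat"
  proof -
    define Y s f where "Y n = fst (t (e n))" and "s n = fst (snd (t (e n)))" and "f n = snd (snd (t (e n)))" for n
    have te: "t (e n) = (Y n, (s n, f n))" for n by (simp add: Y_def s_def f_def)
    have mem: "Y n \<in> Ob C \<and> s n \<in> S \<and> f n \<in> Mor C (fst (s n)) (Y n)" for n
      using t[of "e n"] by (auto simp: te gens_def)
    from good[of Y s f, OF mem] obtain i j g where ij: "i < j" and g: "g \<in> Mor C (Y i) (Y j)"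
      and sj: "s j = s i" and fj: "f j = Cmp C (fst (s i)) (Y i) (Y j) g (f i)"
      and key: "\<forall>s'\<in>S. \<forall>f'\<in>Mor C (fst s') (Y i). key (Y i) (s', f') < key (Y i) (s i, f i) \<longrightarrow>
          key (Y j) (s', Cmp C (fst s') (Y i) (Y j) g f') < key (Y j) (s j, f j)"
      by (elim exE conjE)
    have "act (Y i) (Y j) g ` below (Y i) (s i, f i) \<subseteq> below (Y j) (s j, f j)"
    proof
      fix u assume "u \<in> act (Y i) (Y j) g ` below (Y i) (s i, f i)"
      then obtain u' where u': "u' \<in> gens (Y i)" "key (Y i) u' < key (Y i) (s i, f i)"
        "u = act (Y i) (Y j) g u'" by (auto simp: below_def)
      then have "u \<in> gens (Y j)" using act_gens mem g by blast
      moreover have "key (Y j) u < key (Y j) (s j, f j)"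
        using key[rule_format, of "fst u'" "snd u'"] u' by (auto simp: act_def gens_def)
      ultimately show "u \<in> below (Y j) (s j, f j)" by (simp add: below_def)
    qed
    then have "divides (t (e i)) (t (e j))" using g sj fj by (auto simp: divides_def te act_def)
    then show ?thesis using ij by blast
  qed
  then have "\<exists>e :: nat \<Rightarrow> nat. strict_mono e \<and> (\<forall>i j. i < j \<longrightarrow> divides (t (e i)) (t (e j)))"
    by (intro infinite_chain_if_good_sequences)
  then obtain e :: "nat \<Rightarrow> nat" where e: "strict_mono e"
    and chain: "\<forall>i j. i < j \<longrightarrow> divides (t (e i)) (t (e j))"
    by (elim exE conjE)
  define I where "I n = leading N (fst (t (e n))) (snd (t (e n)))" for n
  have "\<exists>n. I (Suc n) = I n"
  proof (rule coeff.left_ideal_chain_stabilizes)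
    show "submodule (I n) K (self_module K)" for n
      unfolding I_def using leading_left_ideal[OF N] t by blast
    show "I n \<subseteq> I (Suc n)" for n
    proof -
      have "divides (fst (t (e n)), snd (t (e n))) (fst (t (e (Suc n))), snd (t (e (Suc n))))"
        using chain by simp
      then show ?thesis unfolding I_def using leading_mono[OF N] t by blast
    qed
  qed
  then obtain n where "I (Suc n) = I n" by blast
  moreover have "e n < e (Suc n)" using e by (simp add: strict_mono_less)
  moreover have "divides (t (e n)) (t (e (Suc n)))" using chain by simp
  ultimately show ?thesis unfolding I_def by metis
qed

text \<open>Finiteness enters twice: finitely many generators represent all leading ideals up to
  division, and each of these left ideals is finitely generated. The finite generating set of
  \<open>N\<close> consists of elements \<open>\<nu> b k\<close> realizing those coefficients; a
  submodule of \<open>N\<close> that contains them has leading ideals as large as those of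
  \<open>N\<close>, hence equals \<open>N\<close>.\<close>

theorem noetherian: "noetherian_cmodule C K M"
  unfolding noetherian_cmodule_def
proof (intro allI impI)
  fix N assume "csubmodule C K M N"
  then have N: "stable N" by (rule stable_if_csubmodule)
  interpret self: left_module K "self_module K" by (rule coeff.left_module_self)
  let ?T = "SIGMA Y : Ob C. gens Y"
  \<comment> \<open>Divisibility alone would not suffice: a leading ideal may grow along a division,
    so the basis element is also required to have the same leading ideal.\<close>
  have "\<exists>B. finite B \<and> B \<subseteq> ?T \<and> (\<forall>t\<in>?T. \<exists>b\<in>B. divides b t \<and>
      leading N (fst b) (snd b) = leading N (fst t) (snd t))"
  proof (rule finite_basis_if_good_sequences)
    fix t :: "nat \<Rightarrow> 'o \<times> ('o \<times> 'm) \<times> 'a"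
    assume "\<And>n. t n \<in> ?T"
    then have "fst (t n) \<in> Ob C \<and> snd (t n) \<in> gens (fst (t n))" for n by (metis SigmaE fst_conv snd_conv)
    from good_leading[OF N this]
    show "\<exists>i j. i < j \<and> divides (t i) (t j) \<and>
      leading N (fst (t i)) (snd (t i)) = leading N (fst (t j)) (snd (t j))" .
  qed
  then obtain B where B: "finite B" "B \<subseteq> ?T"
    and basis: "\<And>Y t. Y \<in> Ob C \<Longrightarrow> t \<in> gens Y \<Longrightarrow> \<exists>b\<in>B. divides b (Y, t) \<and> leading N (fst b) (snd b) = leading N Y t"
    by fastforce
  have "\<forall>b\<in>B. \<exists>A. finite A \<and> A \<subseteq> leading N (fst b) (snd b) \<and>
      (\<forall>J. submodule J K (self_module K) \<and> A \<subseteq> J \<longrightarrow> leading N (fst b) (snd b) \<subseteq> J)"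
    using B(2) by (intro ballI coeff.left_ideals_finitely_generated leading_left_ideal[OF N]) auto
  then obtain A where A: "\<And>b. b \<in> B \<Longrightarrow> finite (A b)" "\<And>b. b \<in> B \<Longrightarrow> A b \<subseteq> leading N (fst b) (snd b)"
    and A_gen: "\<And>b J. b \<in> B \<Longrightarrow> submodule J K (self_module K) \<Longrightarrow> A b \<subseteq> J \<Longrightarrow> leading N (fst b) (snd b) \<subseteq> J"
    by metis
  have "\<forall>b\<in>B. \<forall>k\<in>A b. \<exists>n\<in>N (fst b). \<exists>z\<in>lower (fst b) (snd b).
      n = k \<odot>\<^bsub>obj_map M (fst b)\<^esub> val (fst b) (snd b) \<oplus>\<^bsub>obj_map M (fst b)\<^esub> z"
    using A(2) unfolding leading_def by blast
  then obtain \<nu> where \<nu>: "\<And>b k. b \<in> B \<Longrightarrow> k \<in> A b \<Longrightarrow> \<nu> b k \<in> N (fst b) \<and> (\<exists>z\<in>lower (fst b) (snd b).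
      \<nu> b k = k \<odot>\<^bsub>obj_map M (fst b)\<^esub> val (fst b) (snd b) \<oplus>\<^bsub>obj_map M (fst b)\<^esub> z)"
    by metis
  let ?S = "(\<lambda>(b, k). (fst b, \<nu> b k)) ` (SIGMA b : B. A b)"
  show "finitely_generated C K (restrict_cmodule M N)"
    unfolding finitely_generated_def
  proof (intro exI[of _ ?S] conjI allI impI)
    show "finite ?S" using A(1) B(1) by auto
    show "?S \<subseteq> (SIGMA X : Ob C. carrier (obj_map (restrict_cmodule M N) X))"
      using \<nu> B(2) by (force simp: restrict_cmodule_def)
    fix N' assume asm: "csubmodule C K (restrict_cmodule M N) N' \<and> (\<forall>(X, x)\<in>?S. x \<in> N' X)"
    then have N': "stable N'" and le: "\<And>Y. Y \<in> Ob C \<Longrightarrow> N' Y \<subseteq> N Y"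
      using stable_if_csubmodule_restrict[OF N] by blast+
    have in_N': "\<nu> b k \<in> N' (fst b)" if "b \<in> B" "k \<in> A b" for b k
      using asm that by force
    have lead: "leading N Y t \<subseteq> leading N' Y t" if Y: "Y \<in> Ob C" and t: "t \<in> gens Y" for Y t
    proof -
      from basis[OF Y t] obtain b where b: "b \<in> B" "divides b (Y, t)"
        "leading N (fst b) (snd b) = leading N Y t" by blast
      have bT: "fst b \<in> Ob C" "snd b \<in> gens (fst b)" using b(1) B(2) by auto
      have "A b \<subseteq> leading N' (fst b) (snd b)"
      proof
        fix k assume k: "k \<in> A b"
        then have "k \<in> carrier K" using A(2)[OF b(1)] unfolding leading_def by blast
        then show "k \<in> leading N' (fst b) (snd b)"
          unfolding leading_def using in_N'[OF b(1) k] \<nu>[OF b(1) k] by blast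
      qed
      then have "leading N (fst b) (snd b) \<subseteq> leading N' (fst b) (snd b)"
        using A_gen[OF b(1) leading_left_ideal[OF N' bT]] by blast
      also have "\<dots> \<subseteq> leading N' Y t"
        using leading_mono[OF N' bT(1) Y bT(2)] b(2) by simp
      finally show ?thesis using b(3) by simp
    qed
    show "\<forall>X\<in>Ob C. N' X = carrier (obj_map (restrict_cmodule M N) X)"
    proof
      fix X assume X: "X \<in> Ob C"
      have "N X \<subseteq> N' X" by (rule subset_if_leading_subset[OF N N' le lead[OF X] X])
      then show "N' X = carrier (obj_map (restrict_cmodule M N) X)"
        using le[OF X] by (simp add: restrict_cmodule_def)
    qed
  qed
qed

end


section \<open>Orthogonal frames\<close>

definition nilpotent_in :: "('r, 'c) ring_scheme \<Rightarrow> 'r \<Rightarrow> bool" where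
  "nilpotent_in R a \<longleftrightarrow> (\<exists>n::nat. a [^]\<^bsub>R\<^esub> n = \<zero>\<^bsub>R\<^esub>)"

text \<open>Powers in a finite monoid become periodic. The exponent 2i + 1 is that of the norm of
  \<open>x\<close>, where x is the i-th power of a times z and a is the norm of z; the statement
  says that a further power of a inverts this norm on x.\<close>

lemma (in monoid) finite_power_quasi_inverse:
  assumes fin: "finite (carrier G)" and a: "a \<in> carrier G"
  shows "\<exists>i r. a [^] (r :: nat) \<otimes> a [^] (2 * i + 1) \<otimes> a [^] i = a [^] (i :: nat)"
proof -
  have "\<not> inj_on (\<lambda>i::nat. a [^] i) UNIV"
    using fin a by (meson finite_subset image_subsetI infinite_UNIV_nat inj_on_finite nat_pow_closed)
  then obtain i j :: nat where ij: "i < j" "a [^] i = a [^] j"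
    unfolding inj_on_def by (metis linorder_neqE_nat)
  define p where "p = j - i"
  have period: "a [^] (i + k * p) = a [^] i" for k
  proof (induction k)
    case (Suc k)
    have "a [^] (i + Suc k * p) = a [^] (i + p) \<otimes> a [^] (k * p)"
      using a by (simp add: nat_pow_mult add.assoc)
    also have "a [^] (i + p) = a [^] i" using ij by (simp add: p_def)
    also have "a [^] i \<otimes> a [^] (k * p) = a [^] (i + k * p)" using a by (simp add: nat_pow_mult)
    finally show ?case using Suc by simp
  qed simp
  \<comment> \<open>Taking r = (2i + 1)(p - 1) makes the total exponent exceed i by a multiple of
    the period p.\<close>
  have "(2 * i + 1) * (p - 1) + (2 * i + 1) + i = i + (2 * i + 1) * p"
    using ij by (cases p) (auto simp: p_def)
  then have "a [^] ((2 * i + 1) * (p - 1)) \<otimes> a [^] (2 * i + 1) \<otimes> a [^] i = a [^] i"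
    using a period[of "2 * i + 1"] by (simp only: nat_pow_mult)
  then show ?thesis by blast
qed

text \<open>The order of the group annihilates every element, so repeating \<open>F p\<close> as
  often as its fibre has elements gives the same sum as taking it once.\<close>

lemma (in abelian_group) finsum_congruent_fibres:
  assumes fin: "finite (carrier G)"
    and s: "\<And>k. k < n \<Longrightarrow> s k < m"
    and fibres: "\<And>p. p < m \<Longrightarrow> card {k. k < n \<and> s k = p} mod card (carrier G) = 1 mod card (carrier G)"
    and F: "\<And>p. p < m \<Longrightarrow> F p \<in> carrier G"
  shows "(\<Oplus>k\<in>{..<n::nat}. F (s k)) = (\<Oplus>p\<in>{..<m::nat}. F p)"
proof -
  have mult_mod: "[c] \<cdot> x = [(c mod card (carrier G))] \<cdot> x" if x: "x \<in> carrier G" for c :: nat and x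
  proof -
    have "[c] \<cdot> x = [(card (carrier G) * (c div card (carrier G)) + c mod card (carrier G))] \<cdot> x" by simp
    also have "\<dots> = [(card (carrier G) * (c div card (carrier G)))] \<cdot> x \<oplus> [(c mod card (carrier G))] \<cdot> x"
      using x by (subst add.nat_pow_mult) auto
    also have "[(card (carrier G) * (c div card (carrier G)))] \<cdot> x = [(c div card (carrier G))] \<cdot> ([(card (carrier G))] \<cdot> x)"
      using x by (simp add: add.nat_pow_pow)
    also have "[(card (carrier G))] \<cdot> x = \<zero>" using add.power_order_eq_one[OF fin x] .
    finally show ?thesis using x by simp
  qed
  have mult_fibre: "[(card {k. k < n \<and> s k = p})] \<cdot> F p = F p" if p: "p < m" for p
    using mult_mod[OF F[OF p], of "card {k. k < n \<and> s k = p}"] mult_mod[OF F[OF p], of 1] fibres[OF p] F[OF p]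
    by simp
  have "{..<n} = (\<Union>p\<in>{..<m}. {k. k < n \<and> s k = p})" using s by auto
  then have "(\<Oplus>k\<in>{..<n}. F (s k)) = (\<Oplus>k\<in>(\<Union>p\<in>{..<m}. {k. k < n \<and> s k = p}). F (s k))" by simp
  also have "\<dots> = (\<Oplus>p\<in>{..<m}. \<Oplus>k\<in>{k. k < n \<and> s k = p}. F (s k))"
    by (rule add.finprod_UN_disjoint) (use F in \<open>auto simp: pairwise_def disjnt_def\<close>)
  also have "\<dots> = (\<Oplus>p\<in>{..<m}. F p)"
  proof (rule add.finprod_cong')
    fix p assume "p \<in> {..<m}"
    then have p: "p < m" by simp
    have "(\<Oplus>k\<in>{k. k < n \<and> s k = p}. F (s k)) = (\<Oplus>k\<in>{k. k < n \<and> s k = p}. F p)"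
      by (rule add.finprod_cong') (use F p in auto)
    also have "\<dots> = [(card {k. k < n \<and> s k = p})] \<cdot> F p" by (rule add.finprod_const[OF F[OF p]])
    also have "\<dots> = F p" by (rule mult_fibre[OF p])
    finally show "(\<Oplus>k\<in>{k. k < n \<and> s k = p}. F (s k)) = F p" .
  qed (use F in auto)
  finally show ?thesis .
qed

text \<open>One nilpotent at a time: replace x by its multiple with the last power of a that does
  not kill it. Scalars commute, so everything that killed x before still kills the multiple.\<close>

lemma (in module) nonzero_killed_by_nilpotents:
  assumes Q: "finite Q" "Q \<subseteq> carrier R" "\<And>a. a \<in> Q \<Longrightarrow> nilpotent_in R a"
    and W: "W \<subseteq> carrier M" "\<And>a x. a \<in> carrier R \<Longrightarrow> x \<in> W \<Longrightarrow> a \<odot>\<^bsub>M\<^esub> x \<in> W"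
    and w: "w \<in> W" "w \<noteq> \<zero>\<^bsub>M\<^esub>"
  shows "\<exists>x\<in>W. x \<noteq> \<zero>\<^bsub>M\<^esub> \<and> (\<forall>a\<in>Q. a \<odot>\<^bsub>M\<^esub> x = \<zero>\<^bsub>M\<^esub>)"
  using Q
proof (induction Q)
  case empty
  then show ?case using w by auto
next
  case (insert a Q)
  then obtain x where x: "x \<in> W" "x \<noteq> \<zero>\<^bsub>M\<^esub>" "\<And>b. b \<in> Q \<Longrightarrow> b \<odot>\<^bsub>M\<^esub> x = \<zero>\<^bsub>M\<^esub>" by auto
  have xM: "x \<in> carrier M" using x W by auto
  have a: "a \<in> carrier R" using insert by auto
  obtain n :: nat where "a [^] n = \<zero>" using insert.prems(2)[of a] by (auto simp: nilpotent_in_def)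
  then have ex: "\<exists>n::nat. a [^] n \<odot>\<^bsub>M\<^esub> x = \<zero>\<^bsub>M\<^esub>" using xM by (intro exI[of _ n]) simp
  define k where "k = (LEAST n::nat. a [^] n \<odot>\<^bsub>M\<^esub> x = \<zero>\<^bsub>M\<^esub>)"
  have k: "a [^] k \<odot>\<^bsub>M\<^esub> x = \<zero>\<^bsub>M\<^esub>" unfolding k_def by (rule LeastI_ex[OF ex])
  have "k \<noteq> 0" using k x(2) xM by (metis R.nat_pow_0 smult_one)
  then obtain j where j: "k = Suc j" by (cases k) auto
  have nz: "a [^] j \<odot>\<^bsub>M\<^esub> x \<noteq> \<zero>\<^bsub>M\<^esub>" using not_less_Least[of j "\<lambda>n. a [^] n \<odot>\<^bsub>M\<^esub> x = \<zero>\<^bsub>M\<^esub>"] j unfolding k_def by auto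
  have "a \<odot>\<^bsub>M\<^esub> (a [^] j \<odot>\<^bsub>M\<^esub> x) = \<zero>\<^bsub>M\<^esub>"
    using k a xM by (simp add: j smult_assoc1[symmetric] R.m_comm)
  moreover have "b \<odot>\<^bsub>M\<^esub> (a [^] j \<odot>\<^bsub>M\<^esub> x) = \<zero>\<^bsub>M\<^esub>" if b: "b \<in> Q" for b
  proof -
    have "b \<in> carrier R" using insert b by auto
    then have "b \<odot>\<^bsub>M\<^esub> (a [^] j \<odot>\<^bsub>M\<^esub> x) = a [^] j \<odot>\<^bsub>M\<^esub> (b \<odot>\<^bsub>M\<^esub> x)"
      using a xM by (simp add: smult_assoc1[symmetric] R.m_comm)
    then show ?thesis using x(3)[OF b] a by simp
  qed
  moreover have "a [^] j \<odot>\<^bsub>M\<^esub> x \<in> W" using W(2) a x(1) by simp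
  ultimately show ?case using nz by blast
qed

section \<open>Bilinear calculus and duality for a nondegenerate form\<close>

context orthogonal_module
begin

lemma form_closed [simp]: "v \<in> carrier V \<Longrightarrow> w \<in> carrier V \<Longrightarrow> B v w \<in> carrier R"
  using linear_right[of v] by (auto simp: linear_maps_def self_module_def)

lemma form_add_right: "\<lbrakk>v \<in> carrier V; w \<in> carrier V; w' \<in> carrier V\<rbrakk> \<Longrightarrow> B v (w \<oplus>\<^bsub>V\<^esub> w') = B v w \<oplus>\<^bsub>R\<^esub> B v w'"
  using linear_right[of v] by (auto simp: linear_maps_def self_module_def)

lemma form_smult_right: "\<lbrakk>v \<in> carrier V; w \<in> carrier V; a \<in> carrier R\<rbrakk> \<Longrightarrow> B v (a \<odot>\<^bsub>V\<^esub> w) = a \<otimes>\<^bsub>R\<^esub> B v w"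
  using linear_right[of v] by (auto simp: linear_maps_def self_module_def)

lemma form_add_left: "\<lbrakk>v \<in> carrier V; w \<in> carrier V; w' \<in> carrier V\<rbrakk> \<Longrightarrow> B (w \<oplus>\<^bsub>V\<^esub> w') v = B w v \<oplus>\<^bsub>R\<^esub> B w' v"
  using linear_left[of v] by (auto simp: linear_maps_def self_module_def)

lemma form_smult_left: "\<lbrakk>v \<in> carrier V; w \<in> carrier V; a \<in> carrier R\<rbrakk> \<Longrightarrow> B (a \<odot>\<^bsub>V\<^esub> w) v = a \<otimes>\<^bsub>R\<^esub> B w v"
  using linear_left[of v] by (auto simp: linear_maps_def self_module_def)

lemma form_zero_left [simp]: "v \<in> carrier V \<Longrightarrow> B \<zero>\<^bsub>V\<^esub> v = \<zero>\<^bsub>R\<^esub>"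
  using form_smult_left[of v "\<zero>\<^bsub>V\<^esub>" "\<zero>\<^bsub>R\<^esub>"] by simp

lemma form_zero_right [simp]: "v \<in> carrier V \<Longrightarrow> B v \<zero>\<^bsub>V\<^esub> = \<zero>\<^bsub>R\<^esub>"
  using form_smult_right[of v "\<zero>\<^bsub>V\<^esub>" "\<zero>\<^bsub>R\<^esub>"] by simp

lemma form_finsum_left:
  assumes "finite I" "f \<in> I \<rightarrow> carrier V" "w \<in> carrier V"
  shows "B (\<Oplus>\<^bsub>V\<^esub>i\<in>I. f i) w = (\<Oplus>\<^bsub>R\<^esub>i\<in>I. B (f i) w)"
  using assms
proof (induction I)
  case empty then show ?case by simp
next
  case (insert i I)
  then have "f i \<in> carrier V" "f \<in> I \<rightarrow> carrier V" by auto
  then show ?case using insert by (simp add: form_add_left Pi_def)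
qed

lemma form_finsum_right:
  assumes "finite I" "f \<in> I \<rightarrow> carrier V" "w \<in> carrier V"
  shows "B w (\<Oplus>\<^bsub>V\<^esub>i\<in>I. f i) = (\<Oplus>\<^bsub>R\<^esub>i\<in>I. B w (f i))"
  using assms
proof (induction I)
  case empty then show ?case by simp
next
  case (insert i I)
  then have "f i \<in> carrier V" "f \<in> I \<rightarrow> carrier V" by auto
  then show ?case using insert by (simp add: form_add_right Pi_def)
qed

lemma form_minus_left: "\<lbrakk>v \<in> carrier V; w \<in> carrier V; w' \<in> carrier V\<rbrakk> \<Longrightarrow> B (w \<ominus>\<^bsub>V\<^esub> w') v = B w v \<ominus>\<^bsub>R\<^esub> B w' v"
proof -
  assume v: "v \<in> carrier V" "w \<in> carrier V" "w' \<in> carrier V"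
  have "B (\<ominus>\<^bsub>V\<^esub> w') v = B ((\<ominus>\<^bsub>R\<^esub> \<one>\<^bsub>R\<^esub>) \<odot>\<^bsub>V\<^esub> w') v" using v by (simp add: smult_l_minus)
  also have "\<dots> = \<ominus>\<^bsub>R\<^esub> B w' v" using v by (subst form_smult_left) (auto simp: R.l_minus)
  finally show ?thesis using v by (simp add: a_minus_def form_add_left)
qed

lemma eq_zero_if_orthogonal_to_all:
  assumes "v \<in> carrier V" "\<And>w. w \<in> carrier V \<Longrightarrow> B v w = \<zero>\<^bsub>R\<^esub>"
  shows "v = \<zero>\<^bsub>V\<^esub>"
proof -
  have "inj_on (\<lambda>v. \<lambda>w\<in>carrier V. B v w) (carrier V)" using nondegenerate by (simp add: bij_betw_def)
  moreover have "(\<lambda>w\<in>carrier V. B v w) = (\<lambda>w\<in>carrier V. B \<zero>\<^bsub>V\<^esub> w)" using assms by (intro restrict_ext) simp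
  ultimately show ?thesis using assms by (auto dest: inj_onD)
qed

lemma linear_form_representable:
  assumes "\<phi> \<in> linear_maps R V (self_module R)"
  shows "\<exists>y\<in>carrier V. \<forall>w\<in>carrier V. \<phi> w = B y w"
proof -
  have "restrict \<phi> (carrier V) \<in> linear_maps R V (self_module R) \<inter> extensional (carrier V)"
    using assms by (auto simp: linear_maps_def)
  then have "restrict \<phi> (carrier V) \<in> (\<lambda>v. \<lambda>w\<in>carrier V. B v w) ` carrier V"
    using nondegenerate by (simp add: bij_betw_def)
  then obtain y where y: "y \<in> carrier V" "restrict \<phi> (carrier V) = (\<lambda>w\<in>carrier V. B y w)" by auto
  have "\<phi> w = B y w" if "w \<in> carrier V" for w using fun_cong[OF y(2), of w] that by simp
  then show ?thesis using y(1) by blast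
qed

lemma finite_carrier:
  assumes "finite (carrier R)"
  shows "finite (carrier V)"
proof -
  obtain n b where nb: "is_basis R V n b" using free_of_finite_rank by blast
  have "carrier V \<subseteq> (\<lambda>c. \<Oplus>\<^bsub>V\<^esub>i\<in>{..<n}. c i \<odot>\<^bsub>V\<^esub> b i) ` ({..<n} \<rightarrow>\<^sub>E carrier R)"
    using nb by (force simp: is_basis_def)
  moreover have "finite ({..<n} \<rightarrow>\<^sub>E carrier R)" using assms by (intro finite_PiE) auto
  ultimately show ?thesis by (meson finite_imageI finite_subset)
qed

text \<open>Coordinates in a basis are unique, hence linear in the vector, and nondegeneracy
  represents each coordinate form by a vector \<open>y i\<close>.\<close>

lemma dual_basis:
  "\<exists>(n :: nat) b y. b \<in> {..<n} \<rightarrow> carrier V \<and> y \<in> {..<n} \<rightarrow> carrier V \<and>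
    (\<forall>z\<in>carrier V. z = (\<Oplus>\<^bsub>V\<^esub>i\<in>{..<n}. B z (y i) \<odot>\<^bsub>V\<^esub> b i))"
proof -
  obtain n b where nb: "is_basis R V n b" using free_of_finite_rank by blast
  then have b: "b \<in> {..<n} \<rightarrow> carrier V" by (simp add: is_basis_def)
  define c where "c v = (THE c. c \<in> {..<n} \<rightarrow>\<^sub>E carrier R \<and> v = (\<Oplus>\<^bsub>V\<^esub>i\<in>{..<n}. c i \<odot>\<^bsub>V\<^esub> b i))" for v
  have c: "c v \<in> {..<n} \<rightarrow>\<^sub>E carrier R" "v = (\<Oplus>\<^bsub>V\<^esub>i\<in>{..<n}. c v i \<odot>\<^bsub>V\<^esub> b i)" if "v \<in> carrier V" for v
  proof -
    have "\<exists>!c. c \<in> {..<n} \<rightarrow>\<^sub>E carrier R \<and> v = (\<Oplus>\<^bsub>V\<^esub>i\<in>{..<n}. c i \<odot>\<^bsub>V\<^esub> b i)"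
      using nb that by (simp add: is_basis_def)
    from theI'[OF this] show "c v \<in> {..<n} \<rightarrow>\<^sub>E carrier R" "v = (\<Oplus>\<^bsub>V\<^esub>i\<in>{..<n}. c v i \<odot>\<^bsub>V\<^esub> b i)"
      by (auto simp: c_def)
  qed
  have c_eq: "c v = d" if "v \<in> carrier V" "d \<in> {..<n} \<rightarrow>\<^sub>E carrier R" "v = (\<Oplus>\<^bsub>V\<^esub>i\<in>{..<n}. d i \<odot>\<^bsub>V\<^esub> b i)" for v d
  proof -
    have "\<exists>!c. c \<in> {..<n} \<rightarrow>\<^sub>E carrier R \<and> v = (\<Oplus>\<^bsub>V\<^esub>i\<in>{..<n}. c i \<odot>\<^bsub>V\<^esub> b i)"
      using nb that(1) by (simp add: is_basis_def)
    then show ?thesis unfolding c_def by (rule the1_equality) (use that(2,3) in blast)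
  qed
  have c_in: "c v i \<in> carrier R" if "v \<in> carrier V" "i < n" for v i using c(1)[OF that(1)] that(2) by auto
  have b_in: "b i \<in> carrier V" if "i < n" for i using b that by auto
  have "(\<lambda>v. c v i) \<in> linear_maps R V (self_module R)" if i: "i < n" for i
    unfolding linear_maps_def
  proof (intro CollectI conjI ballI)
    show "(\<lambda>v. c v i) \<in> carrier V \<rightarrow> carrier (self_module R)" using c_in i by (auto simp: self_module_def)
  next
    fix v w assume vw: "v \<in> carrier V" "w \<in> carrier V"
    have "c (v \<oplus>\<^bsub>V\<^esub> w) = (\<lambda>i\<in>{..<n}. c v i \<oplus>\<^bsub>R\<^esub> c w i)"
    proof (rule c_eq)
      have "v \<oplus>\<^bsub>V\<^esub> w = (\<Oplus>\<^bsub>V\<^esub>i\<in>{..<n}. c v i \<odot>\<^bsub>V\<^esub> b i) \<oplus>\<^bsub>V\<^esub> (\<Oplus>\<^bsub>V\<^esub>i\<in>{..<n}. c w i \<odot>\<^bsub>V\<^esub> b i)"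
        using c(2) vw by simp
      also have "\<dots> = (\<Oplus>\<^bsub>V\<^esub>i\<in>{..<n}. c v i \<odot>\<^bsub>V\<^esub> b i \<oplus>\<^bsub>V\<^esub> c w i \<odot>\<^bsub>V\<^esub> b i)"
        by (rule M.finsum_addf[symmetric]) (use vw c_in b_in in auto)
      also have "\<dots> = (\<Oplus>\<^bsub>V\<^esub>i\<in>{..<n}. (\<lambda>i\<in>{..<n}. c v i \<oplus>\<^bsub>R\<^esub> c w i) i \<odot>\<^bsub>V\<^esub> b i)"
        by (rule M.finsum_cong') (use vw c_in b_in in \<open>auto simp: smult_l_distr\<close>)
      finally show "v \<oplus>\<^bsub>V\<^esub> w = (\<Oplus>\<^bsub>V\<^esub>i\<in>{..<n}. (\<lambda>i\<in>{..<n}. c v i \<oplus>\<^bsub>R\<^esub> c w i) i \<odot>\<^bsub>V\<^esub> b i)" .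
    qed (use vw c_in in auto)
    then show "c (v \<oplus>\<^bsub>V\<^esub> w) i = c v i \<oplus>\<^bsub>self_module R\<^esub> c w i" using i by (simp add: self_module_def)
  next
    fix a v assume av: "a \<in> carrier R" "v \<in> carrier V"
    have "c (a \<odot>\<^bsub>V\<^esub> v) = (\<lambda>i\<in>{..<n}. a \<otimes>\<^bsub>R\<^esub> c v i)"
    proof (rule c_eq)
      have "a \<odot>\<^bsub>V\<^esub> v = a \<odot>\<^bsub>V\<^esub> (\<Oplus>\<^bsub>V\<^esub>i\<in>{..<n}. c v i \<odot>\<^bsub>V\<^esub> b i)"
        using c(2) av by simp
      also have "\<dots> = (\<Oplus>\<^bsub>V\<^esub>i\<in>{..<n}. a \<odot>\<^bsub>V\<^esub> (c v i \<odot>\<^bsub>V\<^esub> b i))"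
        by (rule finsum_smult_ldistr) (use av c_in b_in in auto)
      also have "\<dots> = (\<Oplus>\<^bsub>V\<^esub>i\<in>{..<n}. (\<lambda>i\<in>{..<n}. a \<otimes>\<^bsub>R\<^esub> c v i) i \<odot>\<^bsub>V\<^esub> b i)"
        by (rule M.finsum_cong') (use av c_in b_in in \<open>auto simp: smult_assoc1\<close>)
      finally show "a \<odot>\<^bsub>V\<^esub> v = (\<Oplus>\<^bsub>V\<^esub>i\<in>{..<n}. (\<lambda>i\<in>{..<n}. a \<otimes>\<^bsub>R\<^esub> c v i) i \<odot>\<^bsub>V\<^esub> b i)" .
    qed (use av c_in in auto)
    then show "c (a \<odot>\<^bsub>V\<^esub> v) i = a \<odot>\<^bsub>self_module R\<^esub> c v i" using i by (simp add: self_module_def)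
  qed
  then have "\<forall>i\<in>{..<n}. \<exists>y\<in>carrier V. \<forall>w\<in>carrier V. c w i = B y w"
    using linear_form_representable by auto
  then obtain y where y: "\<And>i. i < n \<Longrightarrow> y i \<in> carrier V" "\<And>i w. i < n \<Longrightarrow> w \<in> carrier V \<Longrightarrow> c w i = B (y i) w"
    by (metis lessThan_iff)
  have "z = (\<Oplus>\<^bsub>V\<^esub>i\<in>{..<n}. B z (y i) \<odot>\<^bsub>V\<^esub> b i)" if z: "z \<in> carrier V" for z
  proof -
    have "z = (\<Oplus>\<^bsub>V\<^esub>i\<in>{..<n}. c z i \<odot>\<^bsub>V\<^esub> b i)" by (rule c(2)[OF z])
    also have "\<dots> = (\<Oplus>\<^bsub>V\<^esub>i\<in>{..<n}. B z (y i) \<odot>\<^bsub>V\<^esub> b i)"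
      by (rule M.finsum_cong') (use z y b_in symmetric in auto)
    finally show ?thesis .
  qed
  then show ?thesis using b y(1) by (intro exI[of _ n] exI[of _ b] exI[of _ y]) auto
qed

end

text \<open>
  The ring need not be local, so \<open>B (v i) (v i)\<close> need not be a unit; \<open>q i\<close> inverts it only on the span of \<open>v i\<close>.
\<close>
definition orthogonal_family ::
  "'r ring \<Rightarrow> ('r, 'v) module \<Rightarrow> ('v \<Rightarrow> 'v \<Rightarrow> 'r) \<Rightarrow> nat \<Rightarrow> (nat \<Rightarrow> 'v) \<Rightarrow> (nat \<Rightarrow> 'r) \<Rightarrow> bool"
where
  "orthogonal_family R V B m v q \<longleftrightarrow>
    (\<forall>i<m. v i \<in> carrier V \<and> q i \<in> carrier R \<and> (q i \<otimes>\<^bsub>R\<^esub> B (v i) (v i)) \<odot>\<^bsub>V\<^esub> v i = v i) \<and>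
    (\<forall>i<m. \<forall>j<m. i \<noteq> j \<longrightarrow> B (v i) (v j) = \<zero>\<^bsub>R\<^esub>)"

definition orthogonal_complement ::
  "'r ring \<Rightarrow> ('r, 'v) module \<Rightarrow> ('v \<Rightarrow> 'v \<Rightarrow> 'r) \<Rightarrow> nat \<Rightarrow> (nat \<Rightarrow> 'v) \<Rightarrow> 'v set"
where
  "orthogonal_complement R V B m v = {y \<in> carrier V. \<forall>i<m. B y (v i) = \<zero>\<^bsub>R\<^esub>}"

definition frame ::
  "'r ring \<Rightarrow> ('r, 'v) module \<Rightarrow> ('v \<Rightarrow> 'v \<Rightarrow> 'r) \<Rightarrow> nat \<Rightarrow> (nat \<Rightarrow> 'v) \<Rightarrow> (nat \<Rightarrow> 'r) \<Rightarrow> bool"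
where
  "frame R V B m v q \<longleftrightarrow> orthogonal_family R V B m v q \<and> orthogonal_complement R V B m v = {\<zero>\<^bsub>V\<^esub>}"

section \<open>Existence of frames and expansion in a frame\<close>

context orthogonal_module
begin

text \<open>Substituting the defining equation of \<open>q i\<close> for \<open>v i\<close> in the
  second argument extends the inversion from \<open>v i\<close> to all values of the form at
  \<open>v i\<close>.\<close>

lemma form_quasi_inverse:
  assumes "orthogonal_family R V B m v q" "i < m" "y \<in> carrier V"
  shows "q i \<otimes>\<^bsub>R\<^esub> B y (v i) \<otimes>\<^bsub>R\<^esub> B (v i) (v i) = B y (v i)"
proof -
  have i: "v i \<in> carrier V" "q i \<in> carrier R" "(q i \<otimes>\<^bsub>R\<^esub> B (v i) (v i)) \<odot>\<^bsub>V\<^esub> v i = v i"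
    using assms by (auto simp: orthogonal_family_def)
  have "B y (v i) = B y ((q i \<otimes>\<^bsub>R\<^esub> B (v i) (v i)) \<odot>\<^bsub>V\<^esub> v i)" using i by simp
  also have "\<dots> = q i \<otimes>\<^bsub>R\<^esub> B (v i) (v i) \<otimes>\<^bsub>R\<^esub> B y (v i)" using i(1,2) assms by (simp add: form_smult_right)
  finally show ?thesis using i(1,2) assms by (simp add: R.m_ac)
qed

lemma form_sum_orthogonal_family:
  assumes fam: "orthogonal_family R V B m v q" and j: "j < m" and c: "\<And>i. i < m \<Longrightarrow> c i \<in> carrier R"
  shows "B (\<Oplus>\<^bsub>V\<^esub>i\<in>{..<m}. c i \<odot>\<^bsub>V\<^esub> v i) (v j) = c j \<otimes>\<^bsub>R\<^esub> B (v j) (v j)"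
proof -
  have v: "\<And>i. i < m \<Longrightarrow> v i \<in> carrier V" using fam by (auto simp: orthogonal_family_def)
  have "B (\<Oplus>\<^bsub>V\<^esub>i\<in>{..<m}. c i \<odot>\<^bsub>V\<^esub> v i) (v j) = (\<Oplus>\<^bsub>R\<^esub>i\<in>{..<m}. B (c i \<odot>\<^bsub>V\<^esub> v i) (v j))"
    by (rule form_finsum_left) (use v c j in auto)
  also have "\<dots> = (\<Oplus>\<^bsub>R\<^esub>i\<in>{..<m}. if j = i then c i \<otimes>\<^bsub>R\<^esub> B (v i) (v j) else \<zero>\<^bsub>R\<^esub>)"
    by (rule R.finsum_cong') (use v c j fam in \<open>auto simp: form_smult_left orthogonal_family_def\<close>)
  also have "\<dots> = c j \<otimes>\<^bsub>R\<^esub> B (v j) (v j)"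
    by (rule R.finsum_singleton) (use v c j in auto)
  finally show ?thesis .
qed

text \<open>Gram-Schmidt with \<open>q i\<close> in the role of the reciprocal of
  \<open>B (v i) (v i)\<close>; the cancellation is \<open>form_quasi_inverse\<close>.\<close>

lemma complement_minus_expansion:
  assumes fam: "orthogonal_family R V B m v q" and y: "y \<in> carrier V"
  shows "y \<ominus>\<^bsub>V\<^esub> (\<Oplus>\<^bsub>V\<^esub>i\<in>{..<m}. (q i \<otimes>\<^bsub>R\<^esub> B y (v i)) \<odot>\<^bsub>V\<^esub> v i) \<in> orthogonal_complement R V B m v"
proof -
  have v: "\<And>i. i < m \<Longrightarrow> v i \<in> carrier V" "\<And>i. i < m \<Longrightarrow> q i \<in> carrier R"
    using fam by (auto simp: orthogonal_family_def)
  let ?s = "\<Oplus>\<^bsub>V\<^esub>i\<in>{..<m}. (q i \<otimes>\<^bsub>R\<^esub> B y (v i)) \<odot>\<^bsub>V\<^esub> v i"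
  have s: "?s \<in> carrier V" by (rule M.finsum_closed) (use v y in auto)
  have "B (y \<ominus>\<^bsub>V\<^esub> ?s) (v j) = \<zero>\<^bsub>R\<^esub>" if j: "j < m" for j
  proof -
    have "B ?s (v j) = B y (v j)"
      using form_sum_orthogonal_family[OF fam j, of "\<lambda>i. q i \<otimes>\<^bsub>R\<^esub> B y (v i)"] v y form_quasi_inverse[OF fam j y] by simp
    then show ?thesis using v[OF j] y s by (simp add: form_minus_left) (simp add: a_minus_def R.r_neg)
  qed
  then show ?thesis using s y by (simp add: orthogonal_complement_def)
qed

text \<open>Replaces an arbitrary second argument by one in the complement without changing its
  pairings with the complement. This confines questions about the complement to values of the form
  on it.\<close>

lemma complement_projection:
  assumes fam: "orthogonal_family R V B m v q" and y: "y \<in> carrier V"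
  shows "\<exists>y'\<in>orthogonal_complement R V B m v. \<forall>z\<in>orthogonal_complement R V B m v. B z y = B z y'"
proof (intro bexI[OF _ complement_minus_expansion[OF assms]] ballI)
  fix z assume z: "z \<in> orthogonal_complement R V B m v"
  then have zV: "z \<in> carrier V" "\<And>i. i < m \<Longrightarrow> B z (v i) = \<zero>\<^bsub>R\<^esub>" by (auto simp: orthogonal_complement_def)
  have v: "\<And>i. i < m \<Longrightarrow> v i \<in> carrier V" "\<And>i. i < m \<Longrightarrow> q i \<in> carrier R"
    using fam by (auto simp: orthogonal_family_def)
  let ?s = "\<Oplus>\<^bsub>V\<^esub>i\<in>{..<m}. (q i \<otimes>\<^bsub>R\<^esub> B y (v i)) \<odot>\<^bsub>V\<^esub> v i"
  have s: "?s \<in> carrier V" by (rule M.finsum_closed) (use v y in auto)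
  have "B z ?s = (\<Oplus>\<^bsub>R\<^esub>i\<in>{..<m}. B z ((q i \<otimes>\<^bsub>R\<^esub> B y (v i)) \<odot>\<^bsub>V\<^esub> v i))"
    by (rule form_finsum_right) (use v y zV in auto)
  also have "\<dots> = \<zero>\<^bsub>R\<^esub>"
    by (rule R.add.finprod_one_eqI) (use v y zV in \<open>auto simp: form_smult_right\<close>)
  finally have "B z ?s = \<zero>\<^bsub>R\<^esub>" .
  then show "B z y = B z (y \<ominus>\<^bsub>V\<^esub> ?s)"
    using zV y s by (simp add: symmetric[of z] form_minus_left) (simp add: a_minus_def)
qed

text \<open>
  Otherwise some nonzero \<open>x\<close> in the complement \<open>W\<close> is killed by all values \<open>B z z\<close>, hence, by polarization, by all
  values of \<open>B\<close> on \<open>W\<close>.  Expanding \<open>z \<in> W\<close> in a basis, with coefficients that are values of \<open>B\<close> on \<open>W\<close>, gives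
  \<open>B x z = 0\<close>, so \<open>x\<close> is orthogonal to everything.
\<close>
lemma complement_has_non_nilpotent_value:
  assumes fin: "finite (carrier R)" and two: "\<one>\<^bsub>R\<^esub> \<oplus>\<^bsub>R\<^esub> \<one>\<^bsub>R\<^esub> \<in> Units R"
    and fam: "orthogonal_family R V B m v q"
    and w: "w \<in> orthogonal_complement R V B m v" "w \<noteq> \<zero>\<^bsub>V\<^esub>"
  shows "\<exists>z\<in>orthogonal_complement R V B m v. \<not> nilpotent_in R (B z z)"
proof (rule ccontr)
  let ?W = "orthogonal_complement R V B m v"
  assume "\<not> ?thesis"
  then have nil: "\<And>z. z \<in> ?W \<Longrightarrow> nilpotent_in R (B z z)" by blast
  have v: "\<And>i. i < m \<Longrightarrow> v i \<in> carrier V" using fam by (auto simp: orthogonal_family_def)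
  have W: "?W \<subseteq> carrier V" by (auto simp: orthogonal_complement_def)
  have W_smult: "\<And>a x. a \<in> carrier R \<Longrightarrow> x \<in> ?W \<Longrightarrow> a \<odot>\<^bsub>V\<^esub> x \<in> ?W"
    using v by (auto simp: orthogonal_complement_def form_smult_left)
  have W_add: "\<And>x y. x \<in> ?W \<Longrightarrow> y \<in> ?W \<Longrightarrow> x \<oplus>\<^bsub>V\<^esub> y \<in> ?W"
    using v by (auto simp: orthogonal_complement_def form_add_left)
  have "finite ?W" using finite_carrier[OF fin] W by (rule finite_subset[rotated])
  then obtain x where x: "x \<in> ?W" "x \<noteq> \<zero>\<^bsub>V\<^esub>" and kill: "\<And>z. z \<in> ?W \<Longrightarrow> B z z \<odot>\<^bsub>V\<^esub> x = \<zero>\<^bsub>V\<^esub>"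
  proof -
    have "(\<lambda>z. B z z) ` ?W \<subseteq> carrier R" using W by auto
    from nonzero_killed_by_nilpotents[OF finite_imageI[OF \<open>finite ?W\<close>] this _ W W_smult w] nil that
    show thesis by auto
  qed
  have xV: "x \<in> carrier V" using x W by auto
  have kill2: "B z z' \<odot>\<^bsub>V\<^esub> x = \<zero>\<^bsub>V\<^esub>" if z: "z \<in> ?W" "z' \<in> ?W" for z z'
  proof -
    have zV: "z \<in> carrier V" "z' \<in> carrier V" using z W by auto
    \<comment> \<open>\<open>t\<close> is the inverse of 2; it removes the factor that polarization
      leaves in front of \<open>B z z'\<close>.\<close>
    obtain t where t: "t \<in> carrier R" "t \<otimes>\<^bsub>R\<^esub> (\<one>\<^bsub>R\<^esub> \<oplus>\<^bsub>R\<^esub> \<one>\<^bsub>R\<^esub>) = \<one>\<^bsub>R\<^esub>" using two by (auto simp: Units_def)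
    let ?b = "B z z'"
    have b: "?b \<in> carrier R" using zV by simp
    have "\<zero>\<^bsub>V\<^esub> = B (z \<oplus>\<^bsub>V\<^esub> z') (z \<oplus>\<^bsub>V\<^esub> z') \<odot>\<^bsub>V\<^esub> x" using kill[OF W_add[OF z]] by simp
    also have "B (z \<oplus>\<^bsub>V\<^esub> z') (z \<oplus>\<^bsub>V\<^esub> z') = (B z z \<oplus>\<^bsub>R\<^esub> ?b) \<oplus>\<^bsub>R\<^esub> (?b \<oplus>\<^bsub>R\<^esub> B z' z')"
      using zV by (simp add: form_add_left form_add_right symmetric[of z' z])
    also have "\<dots> \<odot>\<^bsub>V\<^esub> x = ?b \<odot>\<^bsub>V\<^esub> x \<oplus>\<^bsub>V\<^esub> ?b \<odot>\<^bsub>V\<^esub> x"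
      using zV xV b kill[OF z(1)] kill[OF z(2)] by (simp add: smult_l_distr)
    also have "\<dots> = (\<one>\<^bsub>R\<^esub> \<oplus>\<^bsub>R\<^esub> \<one>\<^bsub>R\<^esub>) \<odot>\<^bsub>V\<^esub> (?b \<odot>\<^bsub>V\<^esub> x)"
      using xV b by (simp add: smult_l_distr)
    finally have "(\<one>\<^bsub>R\<^esub> \<oplus>\<^bsub>R\<^esub> \<one>\<^bsub>R\<^esub>) \<odot>\<^bsub>V\<^esub> (?b \<odot>\<^bsub>V\<^esub> x) = \<zero>\<^bsub>V\<^esub>" by (rule sym)
    then have "t \<odot>\<^bsub>V\<^esub> ((\<one>\<^bsub>R\<^esub> \<oplus>\<^bsub>R\<^esub> \<one>\<^bsub>R\<^esub>) \<odot>\<^bsub>V\<^esub> (?b \<odot>\<^bsub>V\<^esub> x)) = \<zero>\<^bsub>V\<^esub>" using t by simp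
    moreover have "t \<odot>\<^bsub>V\<^esub> ((\<one>\<^bsub>R\<^esub> \<oplus>\<^bsub>R\<^esub> \<one>\<^bsub>R\<^esub>) \<odot>\<^bsub>V\<^esub> (?b \<odot>\<^bsub>V\<^esub> x)) = ?b \<odot>\<^bsub>V\<^esub> x"
      using t xV b by (subst smult_assoc1[symmetric]) auto
    ultimately show ?thesis by simp
  qed
  obtain n b y where b: "b \<in> {..<n::nat} \<rightarrow> carrier V" and y: "y \<in> {..<n} \<rightarrow> carrier V"
    and expand: "\<And>z. z \<in> carrier V \<Longrightarrow> z = (\<Oplus>\<^bsub>V\<^esub>i\<in>{..<n}. B z (y i) \<odot>\<^bsub>V\<^esub> b i)"
    using dual_basis by blast
  have orth: "B x z = \<zero>\<^bsub>R\<^esub>" if z: "z \<in> ?W" for z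
  proof -
    have zV: "z \<in> carrier V" using z W by auto
    have "B x z = B x (\<Oplus>\<^bsub>V\<^esub>i\<in>{..<n}. B z (y i) \<odot>\<^bsub>V\<^esub> b i)" using expand[OF zV] by simp
    also have "\<dots> = (\<Oplus>\<^bsub>R\<^esub>i\<in>{..<n}. B x (B z (y i) \<odot>\<^bsub>V\<^esub> b i))"
      by (rule form_finsum_right) (use b y zV xV in \<open>auto simp: Pi_iff\<close>)
    also have "\<dots> = \<zero>\<^bsub>R\<^esub>"
    proof (rule R.add.finprod_one_eqI)
      fix i assume "i \<in> {..<n}"
      then have i: "b i \<in> carrier V" "y i \<in> carrier V" using b y by auto
      \<comment> \<open>The dual vector \<open>y i\<close> may lie outside the complement. Its
        projection gives the same coefficient, now a value of the form between two elements of the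
        complement, hence a scalar that kills x.\<close>
      obtain y' where y': "y' \<in> ?W" "B z (y i) = B z y'" using complement_projection[OF fam i(2)] z by blast
      have "y' \<in> carrier V" using y' W by auto
      then have "B x (B z y' \<odot>\<^bsub>V\<^esub> b i) = B (B z y' \<odot>\<^bsub>V\<^esub> x) (b i)"
        using i xV zV by (simp add: form_smult_left form_smult_right)
      then show "B x (B z (y i) \<odot>\<^bsub>V\<^esub> b i) = \<zero>\<^bsub>R\<^esub>" using kill2[OF z y'(1)] i y'(2) by simp
    qed
    finally show ?thesis .
  qed
  have "B x y = \<zero>\<^bsub>R\<^esub>" if "y \<in> carrier V" for y
    using complement_projection[OF fam that] x(1) orth by fastforce
  then show False using eq_zero_if_orthogonal_to_all[OF xV] x(2) by blast
qed

text \<open>One vector of the complement is split off at a time. It has nonzero norm, so it is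
  missing from the new complement, and the size of this finite set decreases.\<close>

lemma ex_frame:
  assumes fin: "finite (carrier R)" and two: "\<one>\<^bsub>R\<^esub> \<oplus>\<^bsub>R\<^esub> \<one>\<^bsub>R\<^esub> \<in> Units R"
  shows "\<exists>m v q. frame R V B m v q"
proof -
  have "\<exists>m v q. frame R V B m v q" if "orthogonal_family R V B m v q" for m v q
    using that
  proof (induction "card (orthogonal_complement R V B m v)" arbitrary: m v q rule: less_induct)
    case less
    note fam = less.prems
    let ?W = "orthogonal_complement R V B m v"
    have v: "\<And>i. i < m \<Longrightarrow> v i \<in> carrier V" using fam by (auto simp: orthogonal_family_def)
    have W: "?W \<subseteq> carrier V" by (auto simp: orthogonal_complement_def)
    have finW: "finite ?W" using finite_carrier[OF fin] W by (rule finite_subset[rotated])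
    have zero: "\<zero>\<^bsub>V\<^esub> \<in> ?W" using v by (auto simp: orthogonal_complement_def)
    show ?case
    proof (cases "?W = {\<zero>\<^bsub>V\<^esub>}")
      case True
      then show ?thesis using fam unfolding frame_def by blast
    next
      case False
      then obtain w where "w \<in> ?W" "w \<noteq> \<zero>\<^bsub>V\<^esub>" using zero by blast
      from complement_has_non_nilpotent_value[OF fin two fam this]
      obtain z where z: "z \<in> ?W" "\<not> nilpotent_in R (B z z)" by blast
      have zV: "z \<in> carrier V" using z W by auto
      define a where "a = B z z"
      have a: "a \<in> carrier R" using zV by (simp add: a_def)
      obtain i r :: nat where ir: "a [^]\<^bsub>R\<^esub> r \<otimes>\<^bsub>R\<^esub> a [^]\<^bsub>R\<^esub> (2 * i + 1) \<otimes>\<^bsub>R\<^esub> a [^]\<^bsub>R\<^esub> i = a [^]\<^bsub>R\<^esub> i"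
        using R.finite_power_quasi_inverse[OF fin a] by blast
      \<comment> \<open>The norm a need not act invertibly on z. On this multiple of z it does, by
        the choice of i, and r supplies the quasi-inverse of \<open>B x x\<close>.\<close>
      define x where "x = a [^]\<^bsub>R\<^esub> i \<odot>\<^bsub>V\<^esub> z"
      have xV: "x \<in> carrier V" using a zV by (simp add: x_def)
      have xx: "B x x = a [^]\<^bsub>R\<^esub> (2 * i + 1)"
      proof -
        have "B x x = a [^]\<^bsub>R\<^esub> i \<otimes>\<^bsub>R\<^esub> (a [^]\<^bsub>R\<^esub> i \<otimes>\<^bsub>R\<^esub> a)"
          using a zV by (simp add: x_def form_smult_left form_smult_right a_def)
        also have "\<dots> = a [^]\<^bsub>R\<^esub> (i + i + 1)" using a by (simp add: R.nat_pow_mult[symmetric] R.m_assoc)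
        finally show ?thesis by (simp add: mult_2)
      qed
      have qx: "(a [^]\<^bsub>R\<^esub> r \<otimes>\<^bsub>R\<^esub> B x x) \<odot>\<^bsub>V\<^esub> x = x"
      proof -
        have "(a [^]\<^bsub>R\<^esub> r \<otimes>\<^bsub>R\<^esub> B x x) \<odot>\<^bsub>V\<^esub> x = (a [^]\<^bsub>R\<^esub> r \<otimes>\<^bsub>R\<^esub> a [^]\<^bsub>R\<^esub> (2 * i + 1) \<otimes>\<^bsub>R\<^esub> a [^]\<^bsub>R\<^esub> i) \<odot>\<^bsub>V\<^esub> z"
          unfolding xx unfolding x_def using a zV by (simp add: smult_assoc1)
        then show ?thesis unfolding ir by (simp add: x_def)
      qed
      \<comment> \<open>Non-nilpotency is needed for all powers at once, since the exponent 2i + 1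
        comes from the periodicity of a.\<close>
      have xx_nz: "B x x \<noteq> \<zero>\<^bsub>R\<^esub>" using z(2) unfolding xx nilpotent_in_def a_def by blast
      have xW: "x \<in> ?W" using z(1) a v zV by (auto simp: x_def orthogonal_complement_def form_smult_left)
      have fam': "orthogonal_family R V B (Suc m) (v(m := x)) (q(m := a [^]\<^bsub>R\<^esub> r))"
        unfolding orthogonal_family_def
      proof (intro conjI allI impI)
        fix k assume "k < Suc m"
        then show "(v(m := x)) k \<in> carrier V" "(q(m := a [^]\<^bsub>R\<^esub> r)) k \<in> carrier R"
          "((q(m := a [^]\<^bsub>R\<^esub> r)) k \<otimes>\<^bsub>R\<^esub> B ((v(m := x)) k) ((v(m := x)) k)) \<odot>\<^bsub>V\<^esub> (v(m := x)) k = (v(m := x)) k"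
          using fam xV a qx by (auto simp: orthogonal_family_def less_Suc_eq)
      next
        fix k j assume "k < Suc m" "j < Suc m" "k \<noteq> j"
        then show "B ((v(m := x)) k) ((v(m := x)) j) = \<zero>\<^bsub>R\<^esub>"
          using fam xV xW symmetric[OF xV v] by (auto simp: orthogonal_family_def less_Suc_eq orthogonal_complement_def)
      qed
      have "orthogonal_complement R V B (Suc m) (v(m := x)) \<subseteq> ?W"
        by (auto simp: orthogonal_complement_def less_Suc_eq)
      moreover have "x \<notin> orthogonal_complement R V B (Suc m) (v(m := x))"
        using xx_nz by (auto simp: orthogonal_complement_def)
      ultimately have "orthogonal_complement R V B (Suc m) (v(m := x)) \<subset> ?W" using xW by blast
      then show ?thesis using less.hyps[OF psubset_card_mono[OF finW] fam'] by blast
    qed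
  qed
  from this[of 0] show ?thesis by (simp add: orthogonal_family_def)
qed

lemma frame_expansion:
  assumes fr: "frame R V B m v q" and y: "y \<in> carrier V"
  shows "y = (\<Oplus>\<^bsub>V\<^esub>i\<in>{..<m}. (q i \<otimes>\<^bsub>R\<^esub> B y (v i)) \<odot>\<^bsub>V\<^esub> v i)" (is "y = ?s")
proof -
  have fam: "orthogonal_family R V B m v q" using fr by (simp add: frame_def)
  then have v: "\<And>i. i < m \<Longrightarrow> v i \<in> carrier V" "\<And>i. i < m \<Longrightarrow> q i \<in> carrier R"
    by (auto simp: orthogonal_family_def)
  have s: "?s \<in> carrier V" by (rule M.finsum_closed) (use v y in auto)
  have "y \<ominus>\<^bsub>V\<^esub> ?s = \<zero>\<^bsub>V\<^esub>" using complement_minus_expansion[OF fam y] fr by (simp add: frame_def)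
  then have "(y \<ominus>\<^bsub>V\<^esub> ?s) \<oplus>\<^bsub>V\<^esub> ?s = ?s" using s by simp
  then show ?thesis using y s by (simp add: a_minus_def M.a_assoc M.l_neg)
qed

text \<open>A frame diagonalizes the form with weights \<open>q i\<close>. Written this way,
  \<open>B y z\<close> depends only on the letters' data at each position, which is what a fold can
  preserve.\<close>

lemma frame_parseval:
  assumes fr: "frame R V B m v q" and y: "y \<in> carrier V" and z: "z \<in> carrier V"
  shows "B y z = (\<Oplus>\<^bsub>R\<^esub>i\<in>{..<m}. q i \<otimes>\<^bsub>R\<^esub> B y (v i) \<otimes>\<^bsub>R\<^esub> B z (v i))"
proof -
  have v: "\<And>i. i < m \<Longrightarrow> v i \<in> carrier V" "\<And>i. i < m \<Longrightarrow> q i \<in> carrier R"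
    using fr by (auto simp: frame_def orthogonal_family_def)
  have "B y z = B (\<Oplus>\<^bsub>V\<^esub>i\<in>{..<m}. (q i \<otimes>\<^bsub>R\<^esub> B y (v i)) \<odot>\<^bsub>V\<^esub> v i) z"
    using frame_expansion[OF fr y] by simp
  also have "\<dots> = (\<Oplus>\<^bsub>R\<^esub>i\<in>{..<m}. B ((q i \<otimes>\<^bsub>R\<^esub> B y (v i)) \<odot>\<^bsub>V\<^esub> v i) z)"
    by (rule form_finsum_left) (use v y z in auto)
  also have "\<dots> = (\<Oplus>\<^bsub>R\<^esub>i\<in>{..<m}. q i \<otimes>\<^bsub>R\<^esub> B y (v i) \<otimes>\<^bsub>R\<^esub> B z (v i))"
    by (rule R.finsum_cong') (use v y z in \<open>auto simp: form_smult_left symmetric[of z]\<close>)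
  finally show ?thesis .
qed

end

section \<open>Isometries induced by folds of frames\<close>

definition fold_isometry ::
  "'r ring \<Rightarrow> ('r, 'v) form_module \<Rightarrow> (nat \<Rightarrow> 'v) \<Rightarrow> ('r, 'v) module \<Rightarrow> nat \<Rightarrow> (nat \<Rightarrow> 'v) \<Rightarrow> (nat \<Rightarrow> 'r) \<Rightarrow>
    (nat \<Rightarrow> nat) \<Rightarrow> 'v \<Rightarrow> 'v"
where
  "fold_isometry R Y v W n v' q' s =
    (\<lambda>y\<in>carrier (fst Y). \<Oplus>\<^bsub>W\<^esub>k\<in>{..<n}. (q' k \<otimes>\<^bsub>R\<^esub> snd Y y (v (s k))) \<odot>\<^bsub>W\<^esub> v' k)"

text \<open>Frame vectors may have annihilators, so prescribing their images would require checking
  relations; the coordinate formula is linear because \<open>B\<close> is. The pairing of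
  \<open>g y\<close> with \<open>v' k\<close> is that of y with \<open>v (s k)\<close>. Parseval for
  the target thus repeats each summand of Parseval for the source along its fibre, and
  \<open>finsum_congruent_fibres\<close> removes the repetitions.\<close>

lemma fold_isometry:
  fixes R :: "'r ring" and V W :: "('r, 'v) module"
  assumes V: "orthogonal_module R V B" and W: "orthogonal_module R W B'" and fin: "finite (carrier R)"
    and fr: "frame R V B m v q" and fr': "frame R W B' n v' q'"
    and s: "\<And>k. k < n \<Longrightarrow> s k < m"
    and fibres: "\<And>p. p < m \<Longrightarrow> card {k. k < n \<and> s k = p} mod card (carrier R) = 1 mod card (carrier R)"
    and q_eq: "\<And>k. k < n \<Longrightarrow> q' k = q (s k)"
    and norm_eq: "\<And>k. k < n \<Longrightarrow> B' (v' k) (v' k) = B (v (s k)) (v (s k))"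
  defines "g \<equiv> fold_isometry R (V, B) v W n v' q' s"
  shows "g \<in> isometries R (V, B) (W, B')"
    and "\<And>y k. y \<in> carrier V \<Longrightarrow> k < n \<Longrightarrow> B' (g y) (v' k) = B y (v (s k))"
proof -
  interpret V: orthogonal_module R V B by (rule V)
  interpret W: orthogonal_module R W B' by (rule W)
  have v: "\<And>i. i < m \<Longrightarrow> v i \<in> carrier V" "\<And>i. i < m \<Longrightarrow> q i \<in> carrier R"
    and fam: "orthogonal_family R V B m v q"
    using fr by (auto simp: frame_def orthogonal_family_def)
  have v': "\<And>i. i < n \<Longrightarrow> v' i \<in> carrier W" "\<And>i. i < n \<Longrightarrow> q' i \<in> carrier R"
    and fam': "orthogonal_family R W B' n v' q'"
    using fr' by (auto simp: frame_def orthogonal_family_def)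
  have vs: "\<And>k. k < n \<Longrightarrow> v (s k) \<in> carrier V" using v s by blast
  have g: "g y = (\<Oplus>\<^bsub>W\<^esub>k\<in>{..<n}. (q' k \<otimes>\<^bsub>R\<^esub> B y (v (s k))) \<odot>\<^bsub>W\<^esub> v' k)" if "y \<in> carrier V" for y
    using that by (simp add: g_def fold_isometry_def)
  have g_closed: "g y \<in> carrier W" if "y \<in> carrier V" for y
    unfolding g[OF that] by (rule W.M.finsum_closed) (use that vs v' in auto)
  show coord: "B' (g y) (v' k) = B y (v (s k))" if y: "y \<in> carrier V" and k: "k < n" for y k
  proof -
    have "B' (g y) (v' k) = q' k \<otimes>\<^bsub>R\<^esub> B y (v (s k)) \<otimes>\<^bsub>R\<^esub> B' (v' k) (v' k)"
      unfolding g[OF y] by (rule W.form_sum_orthogonal_family[OF fam' k]) (use y vs v' in auto)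
    also have "\<dots> = B y (v (s k))"
      unfolding q_eq[OF k] norm_eq[OF k] by (rule V.form_quasi_inverse[OF fam s[OF k] y])
    finally show ?thesis .
  qed
  show "g \<in> isometries R (V, B) (W, B')"
    unfolding isometries_def linear_maps_def
  proof (simp, intro conjI ballI)
    show "g \<in> carrier V \<rightarrow> carrier W" using g_closed by blast
    show "g \<in> extensional (carrier V)" by (simp add: g_def fold_isometry_def)
  next
    fix x y assume xy: "x \<in> carrier V" "y \<in> carrier V"
    have "g (x \<oplus>\<^bsub>V\<^esub> y) = (\<Oplus>\<^bsub>W\<^esub>k\<in>{..<n}. (q' k \<otimes>\<^bsub>R\<^esub> B x (v (s k))) \<odot>\<^bsub>W\<^esub> v' k \<oplus>\<^bsub>W\<^esub> (q' k \<otimes>\<^bsub>R\<^esub> B y (v (s k))) \<odot>\<^bsub>W\<^esub> v' k)"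
      unfolding g[OF V.M.add.m_closed[OF xy]]
      by (rule W.M.finsum_cong') (use xy vs v' in \<open>auto simp: V.form_add_left V.R.r_distr W.smult_l_distr\<close>)
    also have "\<dots> = g x \<oplus>\<^bsub>W\<^esub> g y"
      unfolding g[OF xy(1)] g[OF xy(2)] by (rule W.M.finsum_addf) (use xy vs v' in auto)
    finally show "g (x \<oplus>\<^bsub>V\<^esub> y) = g x \<oplus>\<^bsub>W\<^esub> g y" .
  next
    fix a x assume ax: "a \<in> carrier R" "x \<in> carrier V"
    have "g (a \<odot>\<^bsub>V\<^esub> x) = (\<Oplus>\<^bsub>W\<^esub>k\<in>{..<n}. a \<odot>\<^bsub>W\<^esub> ((q' k \<otimes>\<^bsub>R\<^esub> B x (v (s k))) \<odot>\<^bsub>W\<^esub> v' k))"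
      unfolding g[OF V.smult_closed[OF ax]]
      by (rule W.M.finsum_cong')
        (use ax vs v' in \<open>auto simp: V.form_smult_left V.R.m_lcomm W.smult_assoc1[symmetric]\<close>)
    also have "\<dots> = a \<odot>\<^bsub>W\<^esub> g x"
      unfolding g[OF ax(2)] by (rule W.finsum_smult_ldistr[symmetric]) (use ax vs v' in auto)
    finally show "g (a \<odot>\<^bsub>V\<^esub> x) = a \<odot>\<^bsub>W\<^esub> g x" .
  next
    fix y z assume yz: "y \<in> carrier V" "z \<in> carrier V"
    have "B' (g y) (g z) = (\<Oplus>\<^bsub>R\<^esub>k\<in>{..<n}. q' k \<otimes>\<^bsub>R\<^esub> B' (g y) (v' k) \<otimes>\<^bsub>R\<^esub> B' (g z) (v' k))"
      by (rule W.frame_parseval[OF fr']) (use yz g_closed in auto)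
    also have "\<dots> = (\<Oplus>\<^bsub>R\<^esub>k\<in>{..<n}. q (s k) \<otimes>\<^bsub>R\<^esub> B y (v (s k)) \<otimes>\<^bsub>R\<^esub> B z (v (s k)))"
      by (rule V.R.finsum_cong') (use yz vs v s coord q_eq in auto)
    also have "\<dots> = (\<Oplus>\<^bsub>R\<^esub>p\<in>{..<m}. q p \<otimes>\<^bsub>R\<^esub> B y (v p) \<otimes>\<^bsub>R\<^esub> B z (v p))"
      by (rule V.R.finsum_congruent_fibres[OF fin s fibres]) (use yz v in auto)
    also have "\<dots> = B y z" by (rule V.frame_parseval[OF fr yz, symmetric])
    finally show "B y z = B' (g y) (g z)" by simp
  qed
qed


section \<open>Isometries as words\<close>

lemma list_less_iff_first_difference:
  fixes xs ys :: "'a :: linorder list"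
  assumes "length xs = length ys"
  shows "xs < ys \<longleftrightarrow> (\<exists>p<length xs. xs ! p < ys ! p \<and> (\<forall>i<p. xs ! i = ys ! i))"
  using assms
proof (induction xs ys rule: list_induct2)
  case (Cons x xs y ys)
  show ?case
  proof
    assume "x # xs < y # ys"
    then consider "x < y" | "x = y" "xs < ys" by auto
    then show "\<exists>p<length (x # xs). (x # xs) ! p < (y # ys) ! p \<and> (\<forall>i<p. (x # xs) ! i = (y # ys) ! i)"
    proof cases
      case 2
      then obtain p where "p < length xs" "xs ! p < ys ! p" "\<forall>i<p. xs ! i = ys ! i" using Cons.IH by auto
      then show ?thesis using 2 by (intro exI[of _ "Suc p"]) (auto simp: less_Suc_eq_0_disj)
    qed auto
  next
    assume "\<exists>p<length (x # xs). (x # xs) ! p < (y # ys) ! p \<and> (\<forall>i<p. (x # xs) ! i = (y # ys) ! i)"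
    then obtain p where p: "p < Suc (length xs)" "(x # xs) ! p < (y # ys) ! p"
      "\<And>i. i < p \<Longrightarrow> (x # xs) ! i = (y # ys) ! i" by auto
    show "x # xs < y # ys"
    proof (cases p)
      case 0
      then show ?thesis using p by simp
    next
      case (Suc r)
      have "xs ! i = ys ! i" if "i < r" for i using p(3)[of "Suc i"] that Suc by simp
      then have "xs < ys" using p Suc Cons.IH by auto
      then show ?thesis using p(3)[of 0] Suc by simp
    qed
  qed
qed simp

text \<open>A first difference at p becomes a first difference at \<open>\<phi> p\<close>: an
  earlier position k satisfies \<open>\<phi> (s k) \<le> k < \<phi> p\<close>, so
  \<open>s k < p\<close> since \<open>\<phi>\<close> is increasing, and there the words
  agree.\<close>

lemma congruent_fold_less:
  fixes xs' xs'' :: "'b :: linorder list"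
  assumes fold: "congruent_fold l xs ys s" and len: "length xs' = length xs" "length xs'' = length xs"
    and less: "xs' < xs''"
  shows "map (\<lambda>k. xs' ! s k) [0..<length ys] < map (\<lambda>k. xs'' ! s k) [0..<length ys]"
proof -
  obtain \<phi> where mono: "strict_mono_on {..<length xs} \<phi>"
    and sec: "\<And>p. p < length xs \<Longrightarrow> \<phi> p < length ys \<and> s (\<phi> p) = p"
    and le: "\<And>k. k < length ys \<Longrightarrow> \<phi> (s k) \<le> k" and s: "\<And>k. k < length ys \<Longrightarrow> s k < length xs"
    using fold unfolding congruent_fold_def by blast
  obtain p where p: "p < length xs" "xs' ! p < xs'' ! p" "\<And>i. i < p \<Longrightarrow> xs' ! i = xs'' ! i"
    using less len by (auto simp: list_less_iff_first_difference)
  have "s k < p" if k: "k < \<phi> p" for k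
  proof (rule ccontr)
    assume "\<not> s k < p"
    have "k < length ys" using k sec[OF p(1)] by simp
    then have "\<phi> p \<le> \<phi> (s k)"
      using mono \<open>\<not> s k < p\<close> p(1) s by (metis lessThan_iff linorder_le_less_linear order.strict_implies_order order_refl linorder_neqE_nat strict_mono_onD)
    then show False using le[OF \<open>k < length ys\<close>] k by simp
  qed
  then show ?thesis
    using p sec[OF p(1)] by (subst list_less_iff_first_difference) (auto intro!: exI[of _ "\<phi> p"])
qed

text \<open>One frame per object, shared by all isometries into it. Words into the same target
  therefore have equal length and agree in the first two entries of each letter.\<close>

definition chosen_frame :: "'r ring \<Rightarrow> ('r, 'v) form_module \<Rightarrow> nat \<times> (nat \<Rightarrow> 'v) \<times> (nat \<Rightarrow> 'r)" where
  "chosen_frame R Y = (SOME t. frame R (fst Y) (snd Y) (fst t) (fst (snd t)) (snd (snd t)))"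

definition frame_size :: "'r ring \<Rightarrow> ('r, 'v) form_module \<Rightarrow> nat" where
  "frame_size R Y = fst (chosen_frame R Y)"

definition frame_vector :: "'r ring \<Rightarrow> ('r, 'v) form_module \<Rightarrow> nat \<Rightarrow> 'v" where
  "frame_vector R Y = fst (snd (chosen_frame R Y))"

definition frame_scalar :: "'r ring \<Rightarrow> ('r, 'v) form_module \<Rightarrow> nat \<Rightarrow> 'r" where
  "frame_scalar R Y = snd (snd (chosen_frame R Y))"

text \<open>The linear form is cut down to the carrier so that finitely many letters occur even when
  the type \<open>'v\<close> is infinite.\<close>

definition isometry_letter ::
  "'r ring \<Rightarrow> ('r, 'v) form_module \<Rightarrow> ('r, 'v) form_module \<Rightarrow> ('v \<Rightarrow> 'v) \<Rightarrow> nat \<Rightarrow> 'r \<times> 'r \<times> ('v \<Rightarrow> 'r)"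
where
  "isometry_letter R X Y f k = (snd Y (frame_vector R Y k) (frame_vector R Y k), frame_scalar R Y k,
    \<lambda>x\<in>carrier (fst X). snd Y (f x) (frame_vector R Y k))"

definition isometry_word ::
  "'r ring \<Rightarrow> ('r, 'v) form_module \<Rightarrow> ('r, 'v) form_module \<Rightarrow> ('v \<Rightarrow> 'v) \<Rightarrow> ('r \<times> 'r \<times> ('v \<Rightarrow> 'r)) list"
where
  "isometry_word R X Y f = map (isometry_letter R X Y f) [0..<frame_size R Y]"

definition letters :: "'r ring \<Rightarrow> ('r, 'v) form_module \<Rightarrow> ('r \<times> 'r \<times> ('v \<Rightarrow> 'r)) set" where
  "letters R X = carrier R \<times> carrier R \<times> (carrier (fst X) \<rightarrow>\<^sub>E carrier R)"

lemma isometry_wordD: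
  assumes "k < frame_size R Y" "k' < frame_size R Z"
    and "isometry_word R X Y f ! k = isometry_word R X Z f' ! k'"
  shows "snd Y (frame_vector R Y k) (frame_vector R Y k) = snd Z (frame_vector R Z k') (frame_vector R Z k')"
    and "frame_scalar R Y k = frame_scalar R Z k'"
    and "x \<in> carrier (fst X) \<Longrightarrow> snd Y (f x) (frame_vector R Y k) = snd Z (f' x) (frame_vector R Z k')"
proof -
  have eq: "isometry_letter R X Y f k = isometry_letter R X Z f' k'" using assms by (simp add: isometry_word_def)
  then show "snd Y (frame_vector R Y k) (frame_vector R Y k) = snd Z (frame_vector R Z k') (frame_vector R Z k')"
    and "frame_scalar R Y k = frame_scalar R Z k'" by (simp_all add: isometry_letter_def)
  show "snd Y (f x) (frame_vector R Y k) = snd Z (f' x) (frame_vector R Z k')" if "x \<in> carrier (fst X)"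
  proof -
    have "snd (snd (isometry_letter R X Y f k)) x = snd (snd (isometry_letter R X Z f' k')) x" using eq by simp
    then show ?thesis using that by (simp add: isometry_letter_def)
  qed
qed

lemma isometriesD:
  assumes "f \<in> isometries R X Y" "x \<in> carrier (fst X)"
  shows "f x \<in> carrier (fst Y)"
  using assms by (auto simp: isometries_def linear_maps_def)

locale finite_orthogonal_category =
  fixes R :: "'r ring"
  assumes finite_R: "finite (carrier R)" and two: "\<one>\<^bsub>R\<^esub> \<oplus>\<^bsub>R\<^esub> \<one>\<^bsub>R\<^esub> \<in> Units R"
begin

lemma Ob_iff: "Y \<in> Ob (OrI R) \<longleftrightarrow> orthogonal_module R (fst Y) (snd Y)"
  by (cases Y) (simp add: OrI_def)

lemma Mor_eq: "Mor (OrI R) X Y = isometries R X Y"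
  by (simp add: OrI_def)

lemma Cmp_eq: "Cmp (OrI R) X Y Z g f = compose (carrier (fst X)) g f"
  by (simp add: OrI_def)

lemma frame:
  assumes "Y \<in> Ob (OrI R)"
  shows "frame R (fst Y) (snd Y) (frame_size R Y) (frame_vector R Y) (frame_scalar R Y)"
proof -
  have "\<exists>m v q. frame R (fst Y) (snd Y) m v q"
    using orthogonal_module.ex_frame[OF _ finite_R two] assms by (simp add: Ob_iff)
  then have "\<exists>t. frame R (fst Y) (snd Y) (fst t) (fst (snd t)) (snd (snd t))" by auto
  from someI_ex[OF this] show ?thesis
    unfolding chosen_frame_def frame_size_def frame_vector_def frame_scalar_def .
qed

lemma finite_Ob: "Y \<in> Ob (OrI R) \<Longrightarrow> finite (carrier (fst Y))"
  using orthogonal_module.finite_carrier[OF _ finite_R] by (simp add: Ob_iff)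

lemma finite_letters: "X \<in> Ob (OrI R) \<Longrightarrow> finite (letters R X)"
  unfolding letters_def using finite_Ob[of X] finite_R by (intro finite_cartesian_product finite_PiE)

lemma finite_isometries:
  assumes "X \<in> Ob (OrI R)" "Y \<in> Ob (OrI R)"
  shows "finite (Mor (OrI R) X Y)"
proof (rule finite_subset)
  show "Mor (OrI R) X Y \<subseteq> carrier (fst X) \<rightarrow>\<^sub>E carrier (fst Y)"
    by (auto simp: Mor_eq isometries_def linear_maps_def extensional_def)
  show "finite (carrier (fst X) \<rightarrow>\<^sub>E carrier (fst Y))" using finite_Ob assms by (intro finite_PiE)
qed

lemma frame_vector_closed: "Y \<in> Ob (OrI R) \<Longrightarrow> k < frame_size R Y \<Longrightarrow>
    frame_vector R Y k \<in> carrier (fst Y) \<and> frame_scalar R Y k \<in> carrier R"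
  using frame[of Y] by (auto simp: frame_def orthogonal_family_def)

lemma isometry_word_letters:
  assumes Y: "Y \<in> Ob (OrI R)" and f: "f \<in> Mor (OrI R) X Y"
  shows "set (isometry_word R X Y f) \<subseteq> letters R X"
proof -
  interpret Y: orthogonal_module R "fst Y" "snd Y" using Y by (simp add: Ob_iff)
  show ?thesis
    using frame_vector_closed[OF Y] isometriesD[of f R X Y] f
    by (auto simp: isometry_word_def isometry_letter_def letters_def Mor_eq)
qed

text \<open>\<open>frame_expansion\<close> recovers each value from its pairings with the frame; off
  the carrier, extensionality decides.\<close>

lemma isometry_eqI:
  assumes Y: "Y \<in> Ob (OrI R)" and f: "f \<in> Mor (OrI R) X Y" "f' \<in> Mor (OrI R) X Y"
    and eq: "\<And>x k. x \<in> carrier (fst X) \<Longrightarrow> k < frame_size R Y \<Longrightarrow>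
      snd Y (f x) (frame_vector R Y k) = snd Y (f' x) (frame_vector R Y k)"
  shows "f = f'"
proof
  interpret Y: orthogonal_module R "fst Y" "snd Y" using Y by (simp add: Ob_iff)
  fix x
  show "f x = f' x"
  proof (cases "x \<in> carrier (fst X)")
    case True
    then have fx: "f x \<in> carrier (fst Y)" "f' x \<in> carrier (fst Y)"
      using isometriesD[of _ R X Y x] f unfolding Mor_eq by blast+
    have "f x = (\<Oplus>\<^bsub>fst Y\<^esub>k\<in>{..<frame_size R Y}.
        (frame_scalar R Y k \<otimes>\<^bsub>R\<^esub> snd Y (f x) (frame_vector R Y k)) \<odot>\<^bsub>fst Y\<^esub> frame_vector R Y k)"
      by (rule Y.frame_expansion[OF frame[OF Y] fx(1)])
    also have "\<dots> = (\<Oplus>\<^bsub>fst Y\<^esub>k\<in>{..<frame_size R Y}.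
        (frame_scalar R Y k \<otimes>\<^bsub>R\<^esub> snd Y (f' x) (frame_vector R Y k)) \<odot>\<^bsub>fst Y\<^esub> frame_vector R Y k)"
      by (rule Y.M.finsum_cong') (use eq[OF True] fx frame_vector_closed[OF Y] in auto)
    also have "\<dots> = f' x" by (rule Y.frame_expansion[OF frame[OF Y] fx(2), symmetric])
    finally show ?thesis .
  next
    case False
    then show ?thesis using f by (auto simp: Mor_eq isometries_def extensional_def)
  qed
qed

lemma isometry_word_inj:
  assumes Y: "Y \<in> Ob (OrI R)" and f: "f \<in> Mor (OrI R) X Y" "f' \<in> Mor (OrI R) X Y"
    and eq: "isometry_word R X Y f = isometry_word R X Y f'"
  shows "f = f'"
proof (rule isometry_eqI[OF Y f])
  fix x k assume "x \<in> carrier (fst X)" "k < frame_size R Y"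
  then show "snd Y (f x) (frame_vector R Y k) = snd Y (f' x) (frame_vector R Y k)"
    using isometry_wordD(3)[of k R Y k Y X f f'] eq by simp
qed

text \<open>The first two entries of the letters provide the equalities of norms and quasi-inverses
  required by \<open>fold_isometry\<close>; the third identifies h with the composite. Those two
  entries depend on the targets only, so composition with g is pullback along s for every
  \<open>f'\<close> and not just for f, as the comparison of smaller generators demands.\<close>

lemma ex_fold_isometry:
  assumes X: "X \<in> Ob (OrI R)" and Y: "Y \<in> Ob (OrI R)" and Z: "Z \<in> Ob (OrI R)"
    and f: "f \<in> Mor (OrI R) X Y" and h: "h \<in> Mor (OrI R) X Z"
    and fold: "congruent_fold (card (carrier R)) (isometry_word R X Y f) (isometry_word R X Z h) s"
  shows "\<exists>g\<in>Mor (OrI R) Y Z. h = Cmp (OrI R) X Y Z g f \<and>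
    (\<forall>f'\<in>Mor (OrI R) X Y. isometry_word R X Z (Cmp (OrI R) X Y Z g f') =
      map (\<lambda>k. isometry_word R X Y f' ! s k) [0..<frame_size R Z])"
proof -
  let ?m = "frame_size R Y" and ?v = "frame_vector R Y" and ?q = "frame_scalar R Y"
  let ?n = "frame_size R Z" and ?w = "frame_vector R Z" and ?r = "frame_scalar R Z"
  have s: "s k < ?m" and word: "isometry_word R X Z h ! k = isometry_word R X Y f ! s k" if "k < ?n" for k
    using fold that by (auto simp: congruent_fold_def isometry_word_def)
  have fibres: "card {k. k < ?n \<and> s k = p} mod card (carrier R) = 1 mod card (carrier R)" if "p < ?m" for p
    using fold that by (auto simp: congruent_fold_def isometry_word_def)
  note wordD = isometry_wordD[OF _ s word]
  define g where "g = fold_isometry R (fst Y, snd Y) ?v (fst Z) ?n ?w ?r s"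
  have g: "g \<in> Mor (OrI R) Y Z" and coord: "\<And>y k. y \<in> carrier (fst Y) \<Longrightarrow> k < ?n \<Longrightarrow> snd Z (g y) (?w k) = snd Y y (?v (s k))"
    using fold_isometry[of R "fst Y" "snd Y" "fst Z" "snd Z" ?m ?v ?q ?n ?w ?r s]
      frame[OF Y] frame[OF Z] Y Z finite_R s fibres wordD(1,2)
    by (simp_all add: g_def Ob_iff Mor_eq)
  have cmp: "Cmp (OrI R) X Y Z g f' \<in> Mor (OrI R) X Z" if "f' \<in> Mor (OrI R) X Y" for f'
    by (rule category.Cmp_closed[OF category_OrI X Y Z that g])
  have "h = Cmp (OrI R) X Y Z g f"
  proof (rule isometry_eqI[OF Z h cmp[OF f]])
    fix x k assume x: "x \<in> carrier (fst X)" and k: "k < ?n"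
    then show "snd Z (h x) (?w k) = snd Z (Cmp (OrI R) X Y Z g f x) (?w k)"
      using wordD(3)[OF k k k x] coord[OF isometriesD[OF f[unfolded Mor_eq] x] k] x by (simp add: Cmp_eq compose_def)
  qed
  moreover have "isometry_word R X Z (Cmp (OrI R) X Y Z g f') = map (\<lambda>k. isometry_word R X Y f' ! s k) [0..<?n]"
    if f': "f' \<in> Mor (OrI R) X Y" for f'
  proof -
    have "isometry_letter R X Z (Cmp (OrI R) X Y Z g f') k = isometry_letter R X Y f' (s k)" if k: "k < ?n" for k
    proof -
      have "(\<lambda>x\<in>carrier (fst X). snd Z (Cmp (OrI R) X Y Z g f' x) (?w k)) =
          (\<lambda>x\<in>carrier (fst X). snd Y (f' x) (?v (s k)))"
        using coord[OF isometriesD[OF f'[unfolded Mor_eq]] k] by (intro restrict_ext) (simp add: Cmp_eq compose_def)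
      then show ?thesis using wordD(1,2)[OF k k k] by (simp add: isometry_letter_def)
    qed
    then show ?thesis using s by (simp add: isometry_word_def)
  qed
  ultimately show ?thesis using g by blast
qed

text \<open>The numbering of generators and of letters is arbitrary; it merely supplies linear
  orders. Keys at one object that share their head have equal length, so the list order compares
  them at the first differing letter.\<close>

definition generator_key ::
  "(('r, 'v) form_module \<times> 'm) set \<Rightarrow> ('r, 'v) form_module \<Rightarrow> (('r, 'v) form_module \<times> 'm) \<times> ('v \<Rightarrow> 'v) \<Rightarrow> nat list"
where
  "generator_key S Y t = to_nat_on S (fst t) #
    map (to_nat_on (letters R (fst (fst t)))) (isometry_word R (fst (fst t)) Y (snd t))"

text \<open>The head determines the generator and with it the alphabet by which the tail is decoded;
  the word then determines the isometry.\<close>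

lemma generator_key_inj:
  assumes S: "finite S" "fst ` S \<subseteq> Ob (OrI R)" and Y: "Y \<in> Ob (OrI R)"
  shows "inj_on (generator_key S Y) {(s, f). s \<in> S \<and> f \<in> Mor (OrI R) (fst s) Y}"
proof (rule inj_onI)
  fix t u
  assume t: "t \<in> {(s, f). s \<in> S \<and> f \<in> Mor (OrI R) (fst s) Y}" and u: "u \<in> {(s, f). s \<in> S \<and> f \<in> Mor (OrI R) (fst s) Y}"
    and eq: "generator_key S Y t = generator_key S Y u"
  obtain s f s' f' where tu: "t = (s, f)" "u = (s', f')" by fastforce
  have s: "s \<in> S" "f \<in> Mor (OrI R) (fst s) Y" and s': "s' \<in> S" "f' \<in> Mor (OrI R) (fst s') Y" using t u tu by auto
  have "to_nat_on S s = to_nat_on S s'" using eq by (simp add: generator_key_def tu)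
  then have ss: "s' = s" using s(1) s'(1) S(1) by (simp add: countable_finite)
  let ?A = "letters R (fst s)" and ?w = "isometry_word R (fst s) Y"
  have "fst s \<in> Ob (OrI R)" using S(2) s(1) by blast
  then have A: "countable ?A" by (intro countable_finite finite_letters)
  have "map (to_nat_on ?A) (?w f) = map (to_nat_on ?A) (?w f')" using eq by (simp add: generator_key_def tu ss)
  moreover have "inj_on (to_nat_on ?A) (set (?w f) \<union> set (?w f'))"
    by (rule inj_on_subset[OF inj_on_to_nat_on[OF A]])
      (use isometry_word_letters[OF Y s(2)] isometry_word_letters[OF Y, of f' "fst s"] s' ss in auto)
  ultimately have "?w f = ?w f'" by (simp add: inj_on_map_eq_map)
  then show "t = u" using isometry_word_inj[OF Y s(2)] s'(2) by (simp add: tu ss)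
qed

text \<open>Pigeonhole makes the generator constant on a subsequence. All words are then over one
  finite alphabet, and a congruent fold between two of them yields the morphism.\<close>

lemma generator_key_good:
  fixes Y :: "nat \<Rightarrow> ('r, 'v) form_module"
  assumes S: "finite S" "fst ` S \<subseteq> Ob (OrI R)"
    and mem: "\<And>n. Y n \<in> Ob (OrI R) \<and> s n \<in> S \<and> f n \<in> Mor (OrI R) (fst (s n)) (Y n)"
  shows "\<exists>i j g. i < j \<and> g \<in> Mor (OrI R) (Y i) (Y j) \<and> s j = s i \<and>
      f j = Cmp (OrI R) (fst (s i)) (Y i) (Y j) g (f i) \<and>
      (\<forall>s'\<in>S. \<forall>f'\<in>Mor (OrI R) (fst s') (Y i). generator_key S (Y i) (s', f') < generator_key S (Y i) (s i, f i) \<longrightarrow>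
        generator_key S (Y j) (s', Cmp (OrI R) (fst s') (Y i) (Y j) g f') < generator_key S (Y j) (s j, f j))"
proof -
  have "finite (range s)" using mem by (intro finite_subset[OF _ S(1)]) auto
  from pigeonhole_infinite[OF infinite_UNIV_nat this]
  obtain c where inf: "infinite {i. s i = s c}" by auto
  define e where "e = enumerate {i. s i = s c}"
  have e_in: "s (e i) = s c" for i using enumerate_in_set[OF inf] by (auto simp: e_def)
  have e_mono: "strict_mono e" unfolding e_def by (rule strict_mono_enumerate[OF inf])
  define X where "X = fst (s c)"
  have X: "X \<in> Ob (OrI R)" using S(2) mem by (auto simp: X_def)
  have memX: "Y (e i) \<in> Ob (OrI R)" "f (e i) \<in> Mor (OrI R) X (Y (e i))" for i
    using mem[of "e i"] e_in[of i] by (auto simp: X_def)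
  define w where "w i = isometry_word R X (Y (e i)) (f (e i))" for i
  have "0 < card (carrier R)" using two finite_R by (auto simp: card_gt_0_iff Units_def)
  then obtain i j \<sigma> where ij: "i < j" and fold: "congruent_fold (card (carrier R)) (w i) (w j) \<sigma>"
    using congruent_fold_wqo[OF finite_letters[OF X], of w "card (carrier R)"] isometry_word_letters[OF memX]
    by (auto simp: w_def)
  obtain g where g: "g \<in> Mor (OrI R) (Y (e i)) (Y (e j))"
    and f_eq: "f (e j) = Cmp (OrI R) X (Y (e i)) (Y (e j)) g (f (e i))"
    and word: "\<And>f'. f' \<in> Mor (OrI R) X (Y (e i)) \<Longrightarrow> isometry_word R X (Y (e j)) (Cmp (OrI R) X (Y (e i)) (Y (e j)) g f') =
      map (\<lambda>k. isometry_word R X (Y (e i)) f' ! \<sigma> k) [0..<frame_size R (Y (e j))]"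
    using ex_fold_isometry[OF X memX(1) memX(1) memX(2) memX(2) fold[unfolded w_def]] by blast
  have \<sigma>: "\<sigma> k < frame_size R (Y (e i))" if "k < frame_size R (Y (e j))" for k
    using fold that by (auto simp: congruent_fold_def w_def isometry_word_def)
  have "generator_key S (Y (e j)) (s', Cmp (OrI R) (fst s') (Y (e i)) (Y (e j)) g f') <
      generator_key S (Y (e j)) (s (e j), f (e j))"
    if s': "s' \<in> S" and f': "f' \<in> Mor (OrI R) (fst s') (Y (e i))"
      and less: "generator_key S (Y (e i)) (s', f') < generator_key S (Y (e i)) (s (e i), f (e i))" for s' f'
  proof (cases "s' = s c")
    \<comment> \<open>For another generator the words may be over a different alphabet. The heads
      differ, and since composition leaves them unchanged they settle both comparisons
      alike.\<close>
    case False
    have "to_nat_on S s' \<noteq> to_nat_on S (s c)" using False s' mem S(1) by (simp add: countable_finite)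
    then show ?thesis using less by (simp add: generator_key_def e_in)
  next
    case True
    let ?enc = "map (to_nat_on (letters R X))"
    have f': "f' \<in> Mor (OrI R) X (Y (e i))" using f' True by (simp add: X_def)
    have "?enc (isometry_word R X (Y (e i)) f') < ?enc (w i)"
      using less True by (simp add: generator_key_def e_in X_def w_def)
    from congruent_fold_less[OF fold _ _ this]
    have "map (\<lambda>k. ?enc (isometry_word R X (Y (e i)) f') ! \<sigma> k) [0..<frame_size R (Y (e j))] <
        map (\<lambda>k. ?enc (w i) ! \<sigma> k) [0..<frame_size R (Y (e j))]"
      by (simp add: w_def isometry_word_def)
    moreover have "map (\<lambda>k. ?enc (isometry_word R X (Y (e i)) h) ! \<sigma> k) [0..<frame_size R (Y (e j))] =
        ?enc (isometry_word R X (Y (e j)) (Cmp (OrI R) X (Y (e i)) (Y (e j)) g h))"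
      if "h \<in> Mor (OrI R) X (Y (e i))" for h
      unfolding word[OF that] using \<sigma> by (simp add: isometry_word_def)
    ultimately show ?thesis
      using True f' memX(2)[of i] f_eq by (simp add: generator_key_def e_in X_def[symmetric] w_def)
  qed
  then show ?thesis
    using strict_monoD[OF e_mono ij] g f_eq e_in by (intro exI[of _ "e i"] exI[of _ "e j"] exI[of _ g]) (simp add: X_def)
qed

end

theorem theorem3p2:
  fixes R :: "'r ring" and K :: "'k ring"
    and M :: "(('r, 'v) form_module, 'v \<Rightarrow> 'v, 'k, 'm) cmodule_data"
  assumes "cring R" and "finite (carrier R)" and "\<one>\<^bsub>R\<^esub> \<oplus>\<^bsub>R\<^esub> \<one>\<^bsub>R\<^esub> \<in> Units R"
    and "left_noetherian_ring K"
    and "cmodule (OrI R) K M" and "finitely_generated (OrI R) K M"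
  shows "noetherian_cmodule (OrI R) K M"
proof -
  interpret finite_orthogonal_category R using assms(2,3) by unfold_locales
  obtain S where S: "finite S" "S \<subseteq> (SIGMA X : Ob (OrI R). carrier (obj_map M X))"
    and gen: "\<forall>N. csubmodule (OrI R) K M N \<and> (\<forall>(X, x)\<in>S. x \<in> N X) \<longrightarrow>
        (\<forall>X\<in>Ob (OrI R). N X = carrier (obj_map M X))"
    using assms(6) unfolding finitely_generated_def by (elim exE conjE)
  have Ob_S: "fst ` S \<subseteq> Ob (OrI R)" using S(2) by auto
  have "groebner_cmodule (OrI R) K M S (generator_key S)"
  proof (intro groebner_cmodule.intro groebner_cmodule_axioms.intro)
    show "cmodule (OrI R) K M" "left_noetherian_ring K" "finite S"
      "S \<subseteq> (SIGMA X : Ob (OrI R). carrier (obj_map M X))"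
      using assms(4,5) S by blast+
    show "N Y = carrier (obj_map M Y)"
      if "csubmodule (OrI R) K M N" "\<And>X x. (X, x) \<in> S \<Longrightarrow> x \<in> N X" "Y \<in> Ob (OrI R)" for N Y
    proof -
      have "\<forall>(X, x)\<in>S. x \<in> N X" using that(2) by blast
      then show ?thesis using gen that(1,3) by blast
    qed
    show "finite (Mor (OrI R) X Y)" if "(X, x) \<in> S" "Y \<in> Ob (OrI R)" for X x Y
    proof (rule finite_isometries[OF _ that(2)])
      show "X \<in> Ob (OrI R)" using imageI[OF that(1), of fst] Ob_S by auto
    qed
  qed (rule generator_key_inj[OF S(1) Ob_S] generator_key_good[OF S(1) Ob_S]; assumption)+
  then show ?thesis by (rule groebner_cmodule.noetherian)
qed

end
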